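(* Let $\mathcal A,\mathcal B$ be unital $C^*$-algebras with faithful traces $\tau,\omega$, respectively, and let $\phi:\mathcal D_\tau^{-1}(\mathcal A)\to\mathcal D_\omega^{-1}(\mathcal B)$ be a surjective map. Then \[ S_U^\omega(\phi(A)\|\phi(B))=S_U^\tau(A\|B)\quad\text{for all }A,B\in\mathcal D_\tau^{-1}(\mathcal A) \] holds if and only if $\phi$ is of the standard form.
   Context: All $C^*$-algebras are unital; $\mathcal A_+^{-1}$ is the set of positive invertible elements. A trace $\tau$ is a positive linear functional with $\tau(AB)=\tau(BA)$; faithful means $\tau(A)=0$, $A\ge0$ implies $A=0$. $\mathcal D_\tau^{-1}(\mathcal A)=\{A\in\mathcal A_+^{-1}:\tau(A)=1\}$. The Umegaki relative entropy is $S_U^\tau(A\|B)=\tau(A(\log A-\log B))$. A Jordan *-isomorphism $J:\mathcal A\to\mathcal B$ is a linear bijection with $J(XY+YX)=J(X)J(Y)+J(Y)J(X)$ and $J(X^* )=J(X)^*$. The map $\phi$ is of the standard form if there are a central $C\in\mathcal B_+^{-1}$ and a Jordan *-isomorphism $J:\mathcal A\to\mathcal B$ with $\phi(A)=CJ(A)$ for all $A\in\mathcal D_\tau^{-1}(\mathcal A)$ and $\omega(CJ(X))=\tau(X)$ for all $X\in\mathcal A$. *)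

theory Defs
  imports "HOL-Analysis.Analysis"
begin

class cstar_algebra = real_normed_algebra_1 + banach +
  fixes cscale :: "complex \<Rightarrow> 'a \<Rightarrow> 'a"
    and cstar :: "'a \<Rightarrow> 'a"
  assumes cscale_of_real: "cscale (complex_of_real r) x = r *\<^sub>R x"
    and cscale_add_left: "cscale (a + b) x = cscale a x + cscale b x"
    and cscale_add_right: "cscale a (x + y) = cscale a x + cscale a y"
    and cscale_cscale: "cscale a (cscale b x) = cscale (a * b) x"
    and cscale_one: "cscale 1 x = x"
    and mult_cscale_left: "cscale a x * y = cscale a (x * y)"
    and mult_cscale_right: "x * cscale a y = cscale a (x * y)"
    and norm_cscale: "norm (cscale a x) = cmod a * norm x"
    and cstar_cstar: "cstar (cstar x) = x"
    and cstar_add: "cstar (x + y) = cstar x + cstar y"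
    and cstar_cscale: "cstar (cscale a x) = cscale (cnj a) (cstar x)"
    and cstar_mult: "cstar (x * y) = cstar y * cstar x"
    and cstar_identity: "norm (cstar x * x) = (norm x)\<^sup>2"

definition cs_invertible :: "'a::cstar_algebra \<Rightarrow> bool" where
  "cs_invertible A \<longleftrightarrow> (\<exists>B. A * B = 1 \<and> B * A = 1)"

definition cs_spectrum :: "'a::cstar_algebra \<Rightarrow> complex set" where
  "cs_spectrum A = {z. \<not> cs_invertible (A - cscale z 1)}"

definition cs_positive :: "'a::cstar_algebra \<Rightarrow> bool" where
  "cs_positive A \<longleftrightarrow> cstar A = A \<and> cs_spectrum A \<subseteq> {z. z \<in> \<real> \<and> 0 \<le> Re z}"

definition pos_inv :: "'a::cstar_algebra set" where
  "pos_inv = {A. cs_positive A \<and> cs_invertible A}"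

text \<open>Logarithm of a positive invertible element (continuous functional calculus):
the unique self-adjoint element whose exponential is the given element.\<close>
definition cs_log :: "'a::cstar_algebra \<Rightarrow> 'a" where
  "cs_log A = (THE H. cstar H = H \<and> exp H = A)"

definition is_trace :: "('a::cstar_algebra \<Rightarrow> complex) \<Rightarrow> bool" where
  "is_trace \<tau> \<longleftrightarrow>
     (\<forall>x y. \<tau> (x + y) = \<tau> x + \<tau> y) \<and>
     (\<forall>a x. \<tau> (cscale a x) = a * \<tau> x) \<and>
     (\<forall>A. cs_positive A \<longrightarrow> \<tau> A \<in> \<real> \<and> 0 \<le> Re (\<tau> A)) \<and>
     (\<forall>A B. \<tau> (A * B) = \<tau> (B * A))"

definition faithful :: "('a::cstar_algebra \<Rightarrow> complex) \<Rightarrow> bool" where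
  "faithful \<tau> \<longleftrightarrow> (\<forall>A. cs_positive A \<and> \<tau> A = 0 \<longrightarrow> A = 0)"

definition dens :: "('a::cstar_algebra \<Rightarrow> complex) \<Rightarrow> 'a set" where
  "dens \<tau> = {A \<in> pos_inv. \<tau> A = 1}"

definition umegaki :: "('a::cstar_algebra \<Rightarrow> complex) \<Rightarrow> 'a \<Rightarrow> 'a \<Rightarrow> complex" where
  "umegaki \<tau> A B = \<tau> (A * (cs_log A - cs_log B))"

definition jordan_star_iso :: "('a::cstar_algebra \<Rightarrow> 'b::cstar_algebra) \<Rightarrow> bool" where
  "jordan_star_iso J \<longleftrightarrow>
     bij J \<and>
     (\<forall>x y. J (x + y) = J x + J y) \<and>
     (\<forall>a x. J (cscale a x) = cscale a (J x)) \<and>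
     (\<forall>X Y. J (X * Y + Y * X) = J X * J Y + J Y * J X) \<and>
     (\<forall>X. J (cstar X) = cstar (J X))"

definition standard_form ::
  "('a::cstar_algebra \<Rightarrow> complex) \<Rightarrow> ('b::cstar_algebra \<Rightarrow> complex) \<Rightarrow> ('a \<Rightarrow> 'b) \<Rightarrow> bool" where
  "standard_form \<tau> \<omega> \<phi> \<longleftrightarrow>
     (\<exists>C J. C \<in> pos_inv \<and> (\<forall>Y. C * Y = Y * C) \<and> jordan_star_iso J \<and>
        (\<forall>A \<in> dens \<tau>. \<phi> A = C * J A) \<and>
        (\<forall>X. \<omega> (C * J X) = \<tau> X))"

end

theory Submission
  imports Defs
begin

text \<open>
  Suppose $\phi$ preserves the relative entropy. The differences
  $S(A\|B') - S(A\|B) = \tau(A(\log B - \log B'))$ are linear in $A$, and since the elements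
  $\log \phi(B)$ exhaust the self-adjoint elements up to scalars, $\phi$ extends to a linear
  bijection $\Phi$ with $\omega \circ \Phi = \tau$ that preserves positivity in both directions.
  With $D = \Phi(1)$, the map $J = D^{-1/2}\,\Phi(\cdot)\,D^{-1/2}$ is a unital order isomorphism,
  hence a Jordan isomorphism by Kadison's inequality for $J$ and $J^{-1}$. Since
  $\omega(D\,J(\cdot)) = \tau$ vanishes on commutators, and the associator of the Jordan product is a
  double commutator, $\omega(D\,[Y,[X,Z]]) = 0$ for all $X, Y, Z$; taking $X = D$, $Z = Y$
  shows that $D$ is central, so $\Phi = D\,J$.

  Conversely, $J$ commutes with the exponential, so $\log(C J(A)) = \log C + J(\log A)$, and the
  centrality of $C$ gives $\omega(C J(A) J(Y)) = \tau(AY)$.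

  The required part of the theory of $C^*$-algebras rests on the observation that a self-adjoint
  $A$ is positive iff $\|1 - tA\| \le 1 + o(t)$ as $t \to 0^+$, a condition that visibly defines a
  closed convex cone.
\<close>

subsection \<open>Scalars, adjoints and inverses\<close>

text \<open>Positivity is defined through the spectrum, which says nothing visible about sums of
  noncommuting elements; the norm condition does, so the two have to be connected. In one direction,
  a Neumann series inverts \<open>A + r\<close> for accretive \<open>A\<close> and
  \<open>r > 0\<close>. In the other, the segment from 1 to a positive invertible \<open>A\<close>
  consists of invertible elements, so \<open>A\<close> has a self-adjoint logarithm \<open>H\<close>
  and is the square of \<open>exp (H/2)\<close>, and squares of self-adjoint elements satisfy the
  norm condition. This square root commutes with everything that commutes with \<open>A\<close>; it
  does the work usually done by the continuous functional calculus. In Kadison's inequality, a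
  polynomial partition of unity stands in for spectral projections. Neither the traces nor the
  Jordan isomorphisms are assumed continuous; where a bound is needed, it is derived from the
  order.\<close>

lemma cscale_zero [simp]: "cscale 0 x = (0::'a::cstar_algebra)"
  using cscale_of_real[of 0 x] by simp

lemma cscale_zero_right [simp]: "cscale a 0 = (0::'a::cstar_algebra)"
  using cscale_add_right[of a 0 0] by simp

lemma cscale_minus_right: "cscale a (- x) = - cscale a (x::'a::cstar_algebra)"
  using cscale_add_right[of a x "- x"] by (simp add: eq_neg_iff_add_eq_0 add.commute)

lemma cscale_minus_left: "cscale (- a) x = - cscale a (x::'a::cstar_algebra)"
  using cscale_add_left[of a "- a" x] by (simp add: eq_neg_iff_add_eq_0 add.commute)

lemma cscale_diff_right: "cscale a (x - y) = cscale a x - cscale a (y::'a::cstar_algebra)"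
  using cscale_add_right[of a x "- y"] by (simp add: cscale_minus_right)

lemma cscale_scaleR: "cscale a (r *\<^sub>R x) = r *\<^sub>R cscale a (x::'a::cstar_algebra)"
  by (simp add: cscale_of_real[symmetric] cscale_cscale mult.commute)

lemma cscale_of_real_one: "cscale (complex_of_real r) 1 = (of_real r::'a::cstar_algebra)"
  by (subst cscale_of_real) (simp add: scaleR_conv_of_real)

lemma cstar_scaleR: "cstar (r *\<^sub>R x) = r *\<^sub>R cstar (x::'a::cstar_algebra)"
  by (simp add: cscale_of_real[symmetric] cstar_cscale)

lemma cstar_zero [simp]: "cstar 0 = (0::'a::cstar_algebra)"
  using cstar_scaleR[of 0 0] by simp

lemma cstar_minus: "cstar (- x) = - cstar (x::'a::cstar_algebra)"
  using cstar_scaleR[of "-1" x] by simp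

lemma cstar_diff: "cstar (x - y) = cstar x - cstar (y::'a::cstar_algebra)"
  using cstar_add[of x "- y"] by (simp add: cstar_minus)

lemma cstar_one [simp]: "cstar 1 = (1::'a::cstar_algebra)"
  by (metis cstar_cstar cstar_mult mult_1_right)

lemma cstar_of_real [simp]: "cstar (of_real r) = (of_real r::'a::cstar_algebra)"
  by (simp add: of_real_def cstar_scaleR)

lemma norm_cstar [simp]: "norm (cstar x) = norm (x::'a::cstar_algebra)"
proof -
  have le: "norm x \<le> norm (cstar x)" for x :: 'a
  proof (cases "x = 0")
    case False
    have "(norm x)\<^sup>2 \<le> norm (cstar x) * norm x"
      using norm_mult_ineq[of "cstar x" x] by (simp add: cstar_identity)
    then show ?thesis using False by (simp add: power2_eq_square)
  qed simp
  show ?thesis using le[of x] le[of "cstar x"] by (simp add: cstar_cstar)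
qed

lemma bounded_linear_cstar: "bounded_linear (cstar :: 'a::cstar_algebra \<Rightarrow> 'a)"
  by (rule bounded_linear_intro[where K = 1]) (auto simp: cstar_add cstar_scaleR)

lemma cstar_square_eq_0: "cstar x * x = 0 \<Longrightarrow> x = (0::'a::cstar_algebra)"
  by (metis cstar_identity norm_zero norm_eq_zero zero_eq_power2)

lemma cs_invertibleI: "A * B = 1 \<Longrightarrow> B * A = 1 \<Longrightarrow> cs_invertible A"
  by (auto simp: cs_invertible_def)

definition cs_inv :: "'a::cstar_algebra \<Rightarrow> 'a" where
  "cs_inv A = (SOME B. A * B = 1 \<and> B * A = 1)"

lemma
  assumes "cs_invertible A"
  shows cs_inv_right: "A * cs_inv A = 1" and cs_inv_left: "cs_inv A * A = 1"
  using someI_ex[OF assms[unfolded cs_invertible_def]] unfolding cs_inv_def by auto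

lemma cs_inv_commute:
  assumes "cs_invertible A" "A * X = X * A"
  shows "cs_inv A * X = X * cs_inv A"
proof -
  have "cs_inv A * X = cs_inv A * (X * A) * cs_inv A"
    by (simp add: mult.assoc cs_inv_right[OF assms(1)])
  also have "\<dots> = X * cs_inv A"
    unfolding assms(2)[symmetric] by (simp add: mult.assoc[symmetric] cs_inv_left[OF assms(1)])
  finally show ?thesis .
qed

lemma cs_invertible_cs_inv: "cs_invertible A \<Longrightarrow> cs_invertible (cs_inv A)"
  by (rule cs_invertibleI[of _ A]) (auto simp: cs_inv_right cs_inv_left)

lemma cs_invertible_mult:
  assumes "cs_invertible A" "cs_invertible B"
  shows "cs_invertible (A * B)"
proof (rule cs_invertibleI)
  show "A * B * (cs_inv B * cs_inv A) = 1"
    using cs_inv_right[OF assms(1)] cs_inv_right[OF assms(2)] by (metis mult.assoc mult_1_right)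
  show "cs_inv B * cs_inv A * (A * B) = 1"
    using cs_inv_left[OF assms(1)] cs_inv_left[OF assms(2)] by (metis mult.assoc mult_1_right)
qed

lemma cs_invertible_scaleR_iff:
  assumes "r \<noteq> 0"
  shows "cs_invertible (r *\<^sub>R A) \<longleftrightarrow> cs_invertible A"
proof -
  have imp: "cs_invertible (s *\<^sub>R B)" if "s \<noteq> 0" "cs_invertible B" for s and B :: 'a
    using that by (intro cs_invertibleI[of _ "inverse s *\<^sub>R cs_inv B"])
      (auto simp: cs_inv_right cs_inv_left)
  show ?thesis using imp[OF assms, of A] imp[of "inverse r" "r *\<^sub>R A"] assms by auto
qed

lemma cs_invertible_cscale_iff:
  assumes "a \<noteq> 0"
  shows "cs_invertible (cscale a A) \<longleftrightarrow> cs_invertible A"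
proof -
  have imp: "cs_invertible (cscale s B)" if "s \<noteq> 0" "cs_invertible B" for s and B :: 'a
    using that by (intro cs_invertibleI[of _ "cscale (inverse s) (cs_inv B)"])
      (auto simp: cs_inv_right cs_inv_left mult_cscale_left mult_cscale_right cscale_cscale cscale_one)
  show ?thesis using imp[OF assms, of A] imp[of "inverse a" "cscale a A"] assms
    by (auto simp: cscale_cscale cscale_one)
qed

section \<open>Neumann series and the spectrum of self-adjoint elements\<close>

lemma neumann:
  fixes A :: "'a::cstar_algebra"
  assumes "norm (1 - A) < 1"
  shows "cs_invertible A" and "norm (cs_inv A) \<le> 1 / (1 - norm (1 - A))"
proof -
  let ?X = "1 - A"
  let ?S = "\<Sum>n. ?X ^ n"
  have sm: "summable (\<lambda>n. ?X ^ n)" using assms by (rule complete_algebra_summable_geometric)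
  have split: "?S = 1 + (\<Sum>n. ?X ^ Suc n)" using suminf_split_head[OF sm] by simp
  have 1: "(\<Sum>n. ?X ^ Suc n) = ?X * ?S" using suminf_mult[OF sm, of ?X] by simp
  have 2: "(\<Sum>n. ?X ^ Suc n) = ?S * ?X" using suminf_mult2[OF sm, of ?X] by (simp add: power_commutes)
  have "A * ?S = 1" "?S * A = 1" using split 1 2 by (auto simp: algebra_simps)
  then show inv: "cs_invertible A" by (rule cs_invertibleI)
  let ?B = "cs_inv A"
  \<comment> \<open>This fixed-point equation yields the bound without estimating the
    series.\<close>
  have "?B = 1 + ?X * ?B" using cs_inv_right[OF inv] by (simp add: algebra_simps)
  then have "norm ?B \<le> norm (1::'a) + norm ?X * norm ?B"
    by (metis norm_add_rule_thm norm_mult_ineq norm_triangle_le add_left_mono order_trans norm_triangle_ineq)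
  then show "norm ?B \<le> 1 / (1 - norm ?X)"
    using assms by (simp add: field_simps)
qed

lemma cs_invertible_of_cscale_dominant:
  fixes A :: "'a::cstar_algebra"
  assumes "norm A < cmod z"
  shows "cs_invertible (A - cscale z 1)"
proof -
  have z: "z \<noteq> 0" using assms norm_ge_zero[of A] by auto
  have eq: "A - cscale z 1 = cscale (- z) (1 - cscale (inverse z) A)"
    using z by (simp add: cscale_diff_right cscale_cscale cscale_minus_left cscale_one)
  have "norm (cscale (inverse z) A) < 1"
    using assms z by (simp add: norm_cscale norm_inverse norm_divide divide_simps)
  then have "cs_invertible (1 - cscale (inverse z) A)" by (intro neumann(1)) simp
  then show ?thesis unfolding eq using z by (simp add: cs_invertible_cscale_iff)
qed

text \<open>Arens' trick: shifting by a large imaginary scalar increases the norm of a self-adjoint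
  element only to second order.\<close>
lemma cs_spectrum_self_adjoint:
  fixes A :: "'a::cstar_algebra"
  assumes sa: "cstar A = A" and z: "z \<in> cs_spectrum A"
  shows "z \<in> \<real>"
proof (rule ccontr)
  assume "z \<notin> \<real>"
  then have b: "Im z \<noteq> 0" by (simp add: complex_is_Real_iff)
  define H where "H = A - of_real (Re z)"
  have H: "cstar H = H" by (simp add: H_def cstar_diff sa)
  \<comment> \<open>Now \<open>2 * Im z * s\<close> equals |H|^2 + 1 for either sign of
    \<open>Im z\<close>, so (Im z + s)^2 exceeds the bound |H|^2 + s^2 that the C*-identity gives
    for the square of the norm of \<open>?W\<close>.\<close>
  define s where "s = ((norm H)\<^sup>2 + 1) / (2 * Im z)"
  let ?W = "H + cscale (\<i> * of_real s) 1"
  let ?I = "cscale (\<i> * of_real s) (1::'a)"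
  have "cstar ?I = - ?I" by (simp add: cstar_cscale cscale_minus_left)
  moreover have "?I * H = H * ?I" by (simp add: mult_cscale_left mult_cscale_right)
  moreover have "?I * ?I = cscale (complex_of_real (- (s\<^sup>2))) 1"
    by (simp add: mult_cscale_left mult_cscale_right cscale_cscale power2_eq_square algebra_simps)
  then have "?I * ?I = - of_real (s\<^sup>2)"
    by (simp only: cscale_of_real_one cscale_minus_left of_real_minus)
  ultimately have "cstar ?W * ?W = H * H + of_real (s\<^sup>2)"
    by (simp add: cstar_add H algebra_simps)
  then have "(norm ?W)\<^sup>2 = norm (H * H + of_real (s\<^sup>2))"
    by (metis cstar_identity)
  also have "\<dots> \<le> (norm H)\<^sup>2 + s\<^sup>2"
    by (metis norm_triangle_le add_mono norm_mult_ineq norm_of_real power2_eq_square abs_power2 order_refl)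
  also have "\<dots> < (Im z)\<^sup>2 + 2 * Im z * s + s\<^sup>2"
    using b by (simp add: s_def zero_less_power2 add_pos_pos)
  also have "\<dots> = (cmod (\<i> * of_real (Im z + s)))\<^sup>2"
    by (simp only: norm_mult norm_ii norm_of_real mult_1_left power2_abs) (simp add: power2_sum)
  finally have "norm ?W < cmod (\<i> * of_real (Im z + s))" by (rule power2_less_imp_less) simp
  then have "cs_invertible (?W - cscale (\<i> * of_real (Im z + s)) 1)"
    by (rule cs_invertible_of_cscale_dominant)
  moreover have "?W - cscale (\<i> * of_real (Im z + s)) 1 = A - cscale z 1"
  proof -
    have "cscale z (1::'a) = of_real (Re z) + cscale (\<i> * of_real (Im z)) 1"
      by (metis complex_eq cscale_add_left cscale_of_real_one)
    then show ?thesis by (simp add: H_def distrib_left cscale_add_left)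
  qed
  ultimately show False using z by (simp add: cs_spectrum_def)
qed

text \<open>The spectrum of a self-adjoint element is real, so only negative real numbers have to be
  excluded. This form involves real scalars only and is the one verified below.\<close>

lemma cs_positive_iff:
  fixes A :: "'a::cstar_algebra"
  shows "cs_positive A \<longleftrightarrow> cstar A = A \<and> (\<forall>r>0. cs_invertible (A + of_real r))"
proof
  assume A: "cs_positive A"
  show "cstar A = A \<and> (\<forall>r>0. cs_invertible (A + of_real r))"
  proof (intro conjI allI impI)
    show "cstar A = A" using A by (simp add: cs_positive_def)
    fix r :: real assume "r > 0"
    then have "complex_of_real (- r) \<notin> cs_spectrum A" using A by (auto simp: cs_positive_def)
    then have "cs_invertible (A - cscale (complex_of_real (- r)) 1)" by (simp only: cs_spectrum_def mem_Collect_eq not_not)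
    then show "cs_invertible (A + of_real r)" by (simp only: cscale_of_real_one) simp
  qed
next
  assume A: "cstar A = A \<and> (\<forall>r>0. cs_invertible (A + of_real r))"
  have "z \<in> \<real> \<and> 0 \<le> Re z" if z: "z \<in> cs_spectrum A" for z
  proof -
    have re: "z \<in> \<real>" using A z by (intro cs_spectrum_self_adjoint) auto
    then obtain x where x: "z = complex_of_real x" by (auto elim: Reals_cases)
    have "\<not> cs_invertible (A - of_real x)"
      using z by (simp add: x cs_spectrum_def cscale_of_real_one)
    then have "\<not> - x > 0" using A by (metis add_uminus_conv_diff of_real_minus)
    then show ?thesis using x by simp
  qed
  then show "cs_positive A" using A by (auto simp: cs_positive_def)
qed

subsection \<open>Accretive elements\<close>

text \<open>The condition says that the right derivative of |1 - tA| at t = 0 is at most 0;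
  equivalently, the numerical range of \<open>A\<close> lies in the closed right half-plane.
  Self-adjointness is kept separate.\<close>

definition accretive :: "'a::cstar_algebra \<Rightarrow> bool" where
  "accretive A \<longleftrightarrow> (\<forall>e>0. \<exists>d>0. \<forall>t. 0 < t \<and> t < d \<longrightarrow> norm (1 - t *\<^sub>R A) \<le> 1 + e * t)"

lemma accretiveD:
  assumes "accretive A" "e > 0"
  obtains d where "d > 0" "\<And>t. 0 < t \<Longrightarrow> t < d \<Longrightarrow> norm (1 - t *\<^sub>R A) \<le> 1 + e * t"
  using assms unfolding accretive_def by blast

text \<open>1 - t(A + B) is the mean of 1 - 2tA and 1 - 2tB, so the two estimates are simply
  averaged.\<close>

lemma accretive_add:
  fixes A B :: "'a::cstar_algebra"
  assumes "accretive A" "accretive B"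
  shows "accretive (A + B)"
  unfolding accretive_def
proof (intro allI impI)
  fix e :: real assume "e > 0"
  then have e: "e / 2 > 0" by simp
  obtain a where a: "a > 0" "\<And>t. 0 < t \<Longrightarrow> t < a \<Longrightarrow> norm (1 - t *\<^sub>R A) \<le> 1 + e / 2 * t"
    using accretiveD[OF assms(1) e] by blast
  obtain b where b: "b > 0" "\<And>t. 0 < t \<Longrightarrow> t < b \<Longrightarrow> norm (1 - t *\<^sub>R B) \<le> 1 + e / 2 * t"
    using accretiveD[OF assms(2) e] by blast
  have "norm (1 - t *\<^sub>R (A + B)) \<le> 1 + e * t" if "0 < t" "t < min a b / 2" for t
  proof -
    have "2 *\<^sub>R (1 - t *\<^sub>R (A + B)) = (1 - (2 * t) *\<^sub>R A) + (1 - (2 * t) *\<^sub>R B)"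
      by (simp add: algebra_simps flip: scaleR_2)
    then have "2 * norm (1 - t *\<^sub>R (A + B)) = norm ((1 - (2 * t) *\<^sub>R A) + (1 - (2 * t) *\<^sub>R B))"
      by (metis norm_scaleR abs_numeral)
    also have "\<dots> \<le> norm (1 - (2 * t) *\<^sub>R A) + norm (1 - (2 * t) *\<^sub>R B)"
      by (rule norm_triangle_ineq)
    also have "\<dots> \<le> (1 + e / 2 * (2 * t)) + (1 + e / 2 * (2 * t))"
      using that by (intro add_mono a(2) b(2)) auto
    finally show ?thesis by simp
  qed
  then show "\<exists>d>0. \<forall>t. 0 < t \<and> t < d \<longrightarrow> norm (1 - t *\<^sub>R (A + B)) \<le> 1 + e * t"
    using a(1) b(1) by (intro exI[of _ "min a b / 2"]) auto
qed

text \<open>Replacing \<open>B\<close> by \<open>A\<close> costs t|A - B|, which is linear in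
  \<open>t\<close> and fits into the slack \<open>e * t\<close>. This is the closedness of the
  cone.\<close>

lemma accretive_near:
  fixes A :: "'a::cstar_algebra"
  assumes "\<And>e. e > 0 \<Longrightarrow> \<exists>B. accretive B \<and> norm (A - B) < e"
  shows "accretive A"
  unfolding accretive_def
proof (intro allI impI)
  fix e :: real assume "e > 0"
  then have e: "e / 2 > 0" by simp
  then obtain B where B: "accretive B" "norm (A - B) < e / 2" using assms by blast
  obtain d where d: "d > 0" "\<And>t. 0 < t \<Longrightarrow> t < d \<Longrightarrow> norm (1 - t *\<^sub>R B) \<le> 1 + e / 2 * t"
    using accretiveD[OF B(1) e] by blast
  have "norm (1 - t *\<^sub>R A) \<le> 1 + e * t" if t: "0 < t" "t < d" for t
  proof -
    have "norm (1 - t *\<^sub>R A) = norm ((1 - t *\<^sub>R B) - t *\<^sub>R (A - B))" by (simp add: algebra_simps)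
    also have "\<dots> \<le> norm (1 - t *\<^sub>R B) + t * norm (A - B)"
      by (rule order_trans[OF norm_triangle_ineq4]) (use t in simp)
    also have "\<dots> \<le> (1 + e / 2 * t) + t * (e / 2)"
      using B(2) t d(2) by (intro add_mono mult_left_mono) auto
    finally show ?thesis by (simp add: algebra_simps)
  qed
  then show "\<exists>d>0. \<forall>t. 0 < t \<and> t < d \<longrightarrow> norm (1 - t *\<^sub>R A) \<le> 1 + e * t"
    using d(1) by blast
qed

text \<open>As long as \<open>t * r\<close> is at most 1, the scalar part 1 - tr is nonnegative and
  its defect tr pays for the norm of tA. Hence 1 is an order unit for the self-adjoint
  elements.\<close>

lemma accretive_of_norm_le:
  fixes A :: "'a::cstar_algebra"
  assumes "norm A \<le> r"
  shows "accretive (of_real r + A)"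
  unfolding accretive_def
proof (intro allI impI exI conjI)
  have r: "r \<ge> 0" using assms norm_ge_zero[of A] by linarith
  show "0 < 1 / (r + 1)" using r by simp
  fix e t :: real assume e: "e > 0" and t: "0 < t \<and> t < 1 / (r + 1)"
  have "t * r \<le> t * (r + 1)" using t by (simp add: algebra_simps)
  also have "\<dots> \<le> 1" using t r by (simp add: field_simps)
  finally have tr: "t * r \<le> 1" .
  have "norm (1 - t *\<^sub>R (of_real r + A)) = norm (of_real (1 - t * r) - t *\<^sub>R A)"
    by (simp add: scaleR_conv_of_real distrib_left diff_diff_eq)
  also have "\<dots> \<le> (1 - t * r) + t * norm A"
    by (rule order_trans[OF norm_triangle_ineq4]) (use t tr in \<open>simp add: norm_of_real del: of_real_diff\<close>)
  also have "\<dots> \<le> 1" using assms t by (simp add: mult_left_mono)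
  also have "\<dots> \<le> 1 + e * t" using e t by simp
  finally show "norm (1 - t *\<^sub>R (of_real r + A)) \<le> 1 + e * t" .
qed

text \<open>A resolvent bound of Hille-Yosida type. For t = s/(1 + sm) one has 1 - t(A + m) = (1 -
  sA)/(1 + sm), whose norm is below 1 for small s, so the Neumann series inverts t(A + m). The slack
  \<open>e\<close> is finally sent to 0, which gives the sharp constant 1/m needed to compare order
  and norm.\<close>

lemma accretive_add_of_real_inv:
  fixes A :: "'a::cstar_algebra"
  assumes A: "accretive A" and m: "m > 0"
  shows "cs_invertible (A + of_real m)" and "norm (cs_inv (A + of_real m)) \<le> 1 / m"
proof -
  let ?B = "A + of_real m"
  have bd: "cs_invertible ?B \<and> norm (cs_inv ?B) \<le> 1 / (m - e)" if e: "0 < e" "e < m" for e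
  proof -
    obtain d where d: "d > 0" "\<And>t. 0 < t \<Longrightarrow> t < d \<Longrightarrow> norm (1 - t *\<^sub>R A) \<le> 1 + e * t"
      using accretiveD[OF A e(1)] by blast
    define s where "s = min (d / 2) 1"
    have s: "0 < s" "s < d" using d(1) by (auto simp: s_def)
    define t where "t = s / (1 + s * m)"
    have p: "0 < 1 + s * m" using s m by (simp add: add_pos_pos)
    then have t: "t > 0" using s by (simp add: t_def)
    have "1 - t *\<^sub>R ?B = (1 / (1 + s * m)) *\<^sub>R (1 - s *\<^sub>R A)"
    proof -
      have "1 - t * m = 1 / (1 + s * m)" using p by (simp add: t_def field_simps)
      moreover have "1 - t *\<^sub>R ?B = (1 - t * m) *\<^sub>R 1 - t *\<^sub>R A"
        by (simp add: algebra_simps of_real_def)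
      moreover have "t *\<^sub>R A = (1 / (1 + s * m)) *\<^sub>R s *\<^sub>R A" by (simp add: t_def)
      ultimately show ?thesis by (simp only: scaleR_diff_right)
    qed
    then have "norm (1 - t *\<^sub>R ?B) = 1 / (1 + s * m) * norm (1 - s *\<^sub>R A)"
      using p by simp
    also have "\<dots> \<le> 1 / (1 + s * m) * (1 + e * s)"
      using p d(2)[OF s] by (intro mult_left_mono) auto
    also have "\<dots> = 1 - t * (m - e)" using p by (simp add: t_def field_simps)
    finally have n: "norm (1 - t *\<^sub>R ?B) \<le> 1 - t * (m - e)" .
    moreover have "t * (m - e) > 0" using t e by simp
    ultimately have lt: "norm (1 - t *\<^sub>R ?B) < 1" by linarith
    then have inv: "cs_invertible ?B" using neumann(1) t by (metis cs_invertible_scaleR_iff less_irrefl)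
    have "t *\<^sub>R cs_inv (t *\<^sub>R ?B) = t *\<^sub>R cs_inv (t *\<^sub>R ?B) * (?B * cs_inv ?B)"
      by (simp add: cs_inv_right[OF inv])
    also have "\<dots> = (cs_inv (t *\<^sub>R ?B) * (t *\<^sub>R ?B)) * cs_inv ?B"
      by (simp add: mult.assoc)
    also have "\<dots> = cs_inv ?B" using cs_inv_left[OF neumann(1)[OF lt]] by simp
    finally have "norm (cs_inv ?B) = t * norm (cs_inv (t *\<^sub>R ?B))" using t by (metis norm_scaleR abs_of_pos)
    also have "\<dots> \<le> t * (1 / (1 - norm (1 - t *\<^sub>R ?B)))"
      using neumann(2)[OF lt] t by (intro mult_left_mono) auto
    also have "\<dots> \<le> t * (1 / (t * (m - e)))"
      using n t e by (intro mult_left_mono divide_left_mono) (auto intro!: mult_pos_pos simp: lt)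
    finally show ?thesis using inv t by simp
  qed
  show "cs_invertible ?B" using bd[of "m / 2"] m by simp
  have "norm (cs_inv ?B) * (m - e) \<le> 1" if "0 < e" "e < m" for e
    using bd[OF that] that by (simp add: field_simps)
  then have "norm (cs_inv ?B) * m \<le> 1 + norm (cs_inv ?B) * e" if "0 < e" "e < m" for e
    using that by (simp add: algebra_simps)
  then have ev: "\<forall>\<^sub>F e in at_right 0. norm (cs_inv ?B) * m \<le> 1 + norm (cs_inv ?B) * e"
    using m unfolding eventually_at_right_field by blast
  have lim: "((\<lambda>e. 1 + norm (cs_inv ?B) * e) \<longlongrightarrow> 1) (at_right 0)"
    by (auto intro!: tendsto_eq_intros)
  have "norm (cs_inv ?B) * m \<le> 1"
    by (rule tendsto_lowerbound[OF lim ev trivial_limit_at_right_real])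
  then show "norm (cs_inv ?B) \<le> 1 / m" using m by (simp add: field_simps)
qed

subsection \<open>Exponentials\<close>

text \<open>Since (n+k)! >= n!, the tail is dominated by |x|^k times the exponential series of |x|.
  The case k = 2 serves the derivative at 0 and the uniqueness of logarithms, k = 3 the accretivity
  of squares.\<close>

lemma norm_exp_remainder:
  fixes x :: "'a::{real_normed_algebra_1,banach}"
  shows "norm (exp x - (\<Sum>n<k. inverse (fact n) *\<^sub>R x ^ n)) \<le> norm x ^ k * exp (norm x)"
proof -
  have summand: "norm (inverse (fact (n + k)) *\<^sub>R x ^ (n + k)) \<le> norm x ^ k * (norm x ^ n /\<^sub>R fact n)" for n
  proof -
    have f: "inverse (fact (n + k)) \<le> (inverse (fact n) :: real)"
      by (intro le_imp_inverse_le fact_mono) auto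
    have "norm (inverse (fact (n + k)) *\<^sub>R x ^ (n + k)) \<le> inverse (fact n) * norm x ^ (n + k)"
      unfolding norm_scaleR using f norm_power_ineq[of x "n + k"] by (intro mult_mono) auto
    then show ?thesis by (simp add: power_add mult_ac)
  qed
  have sums: "(\<lambda>n. norm x ^ k * (norm x ^ n /\<^sub>R fact n)) sums (norm x ^ k * exp (norm x))"
    by (intro sums_mult exp_converges)
  have "exp x - (\<Sum>n<k. inverse (fact n) *\<^sub>R x ^ n) = (\<Sum>n. inverse (fact (n + k)) *\<^sub>R x ^ (n + k))"
    using exp_first_terms[of x k] by simp
  also have "norm \<dots> \<le> (\<Sum>n. norm x ^ k * (norm x ^ n /\<^sub>R fact n))"
    using summand sums_summable[OF sums] by (intro norm_suminf_le) auto
  finally show ?thesis using sums_unique[OF sums] by simp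
qed

text \<open>At a general point the derivative of \<open>exp\<close> mixes noncommuting factors; the
  construction of logarithms first splits off a commuting factor and then differentiates only at
  0.\<close>

lemma exp_has_derivative_0:
  "(exp has_derivative (\<lambda>h. h)) (at (0::'a::{real_normed_algebra_1,banach}))"
  unfolding has_derivative_at
proof (intro conjI)
  show "(\<lambda>h::'a. norm (exp (0 + h) - exp 0 - h) / norm h) \<midarrow>0\<rightarrow> 0"
  proof (rule Lim_null_comparison)
    show "\<forall>\<^sub>F h::'a in at 0. norm (norm (exp (0 + h) - exp 0 - h) / norm h) \<le> norm h * exp (norm h)"
    proof (rule always_eventually, rule allI)
      fix h :: 'a
      show "norm (norm (exp (0 + h) - exp 0 - h) / norm h) \<le> norm h * exp (norm h)"
        using norm_exp_remainder[of h 2]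
        by (cases "h = 0") (simp_all add: numeral_2_eq_2 field_simps)
    qed
    show "(\<lambda>h::'a. norm h * exp (norm h)) \<midarrow>0\<rightarrow> 0" by (auto intro!: tendsto_eq_intros)
  qed
qed (rule bounded_linear_ident)

lemma cs_exp_commute:
  fixes x y :: "'a::{real_normed_algebra_1,banach}"
  assumes "x * y = y * x"
  shows "exp x * y = y * exp x"
proof -
  have p: "x ^ n * y = y * x ^ n" for n using assms by (simp add: power_commuting_commutes)
  have s: "summable (\<lambda>n. x ^ n /\<^sub>R fact n)" by (rule summable_exp_generic)
  show ?thesis unfolding exp_def using suminf_mult[OF s, of y] suminf_mult2[OF s, of y] by (simp add: p)
qed

lemma bounded_linear_exp:
  assumes "bounded_linear f" "\<And>n. f (x ^ n) = y ^ n"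
  shows "f (exp x) = exp (y::'a::{real_normed_algebra_1,banach})"
  unfolding exp_def bounded_linear.suminf[OF assms(1) summable_exp_generic]
  by (simp add: bounded_linear.linear[OF assms(1), THEN linear_scale] assms(2))

lemma cstar_power: "cstar (x ^ n) = cstar x ^ n"
  by (induction n) (auto simp: cstar_mult power_commutes)

lemma cstar_exp: "cstar (exp x) = exp (cstar x)"
  using bounded_linear_exp[OF bounded_linear_cstar cstar_power] .

lemma exp_minus_inverse': "exp (- x) * exp x = (1::'a::{real_normed_algebra_1,banach})"
  using exp_minus_inverse[of "- x"] by simp

lemma cs_invertible_exp: "cs_invertible (exp x)"
  by (rule cs_invertibleI[OF exp_minus_inverse exp_minus_inverse'])

lemma exp_half_square: "exp ((1/2) *\<^sub>R H) * exp ((1/2) *\<^sub>R H) = exp (H::'a::{real_normed_algebra_1,banach})"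
  by (subst exp_add_commuting[symmetric]) (auto simp flip: scaleR_add_left)

lemma norm_exp_ii_self_adjoint:
  fixes A :: "'a::cstar_algebra"
  assumes "cstar A = A"
  shows "norm (exp (cscale (\<i> * of_real s) A)) = 1"
proof -
  let ?X = "cscale (\<i> * of_real s) A"
  have "cstar (exp ?X) * exp ?X = exp (- ?X) * exp ?X"
    by (simp add: cstar_exp cstar_cscale assms cscale_minus_left)
  then show ?thesis using cstar_identity[of "exp ?X"]
    by (simp add: exp_minus_inverse' power2_eq_1_iff) (metis norm_ge_zero not_one_le_zero neg_0_le_iff_le)
qed

text \<open>Up to third order, $1 - s^2A^2/2$ is the mean of the unitaries $e^{\pm isA}$.\<close>
lemma accretive_square:
  fixes A :: "'a::cstar_algebra"
  assumes sa: "cstar A = A"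
  shows "accretive (A * A)"
  unfolding accretive_def
proof (intro allI impI)
  fix e :: real assume e: "e > 0"
  define M where "M = norm A ^ 3 * exp (norm A)"
  have bd: "norm (1 - (s\<^sup>2 / 2) *\<^sub>R (A * A)) \<le> 1 + M * s ^ 3" if s: "0 < s" "s \<le> 1" for s
  proof -
    let ?X = "cscale (\<i> * of_real s) A" and ?Y = "cscale (\<i> * of_real (- s)) A"
    have Y: "?Y = - ?X" by (simp add: cscale_minus_left)
    have XX: "?X * ?X = - (s\<^sup>2) *\<^sub>R (A * A)"
      by (simp add: mult_cscale_left mult_cscale_right cscale_cscale power2_eq_square algebra_simps
          cscale_minus_left cscale_of_real flip: of_real_mult)
    have nX: "norm ?X = s * norm A" using s by (simp add: norm_cscale norm_mult)
    have r: "norm (exp x - (1 + x + (1/2) *\<^sub>R (x * x))) \<le> M * s ^ 3" if "norm x = s * norm A" for x :: 'a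
    proof -
      have "norm (exp x - (1 + x + (1/2) *\<^sub>R (x * x))) \<le> norm x ^ 3 * exp (norm x)"
        using norm_exp_remainder[of x 3] by (simp add: numeral_3_eq_3 algebra_simps)
      also have "\<dots> \<le> norm x ^ 3 * exp (norm A)"
        using s that by (intro mult_left_mono) (auto simp: mult_left_le_one_le)
      also have "\<dots> = M * s ^ 3" by (simp add: that M_def power_mult_distrib)
      finally show ?thesis .
    qed
    have "2 *\<^sub>R (1 - (s\<^sup>2 / 2) *\<^sub>R (A * A)) = exp ?X + exp ?Y
        - ((exp ?X - (1 + ?X + (1/2) *\<^sub>R (?X * ?X))) + (exp ?Y - (1 + ?Y + (1/2) *\<^sub>R (?Y * ?Y))))"
    proof -
      have "(1/2) *\<^sub>R (?X * ?X) + (1/2) *\<^sub>R (?Y * ?Y) = - (s\<^sup>2) *\<^sub>R (A * A)"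
        unfolding Y minus_mult_minus XX by (simp only: flip: scaleR_add_left) simp
      then show ?thesis unfolding Y by (simp add: algebra_simps scaleR_2)
    qed
    then have "2 * norm (1 - (s\<^sup>2 / 2) *\<^sub>R (A * A)) = norm (exp ?X + exp ?Y
        - ((exp ?X - (1 + ?X + (1/2) *\<^sub>R (?X * ?X))) + (exp ?Y - (1 + ?Y + (1/2) *\<^sub>R (?Y * ?Y)))))"
      by (metis norm_scaleR abs_numeral)
    also have "\<dots> \<le> (1 + 1) + (M * s ^ 3 + M * s ^ 3)"
    proof (rule order_trans[OF norm_triangle_ineq4], rule add_mono)
      show "norm (exp ?X + exp ?Y) \<le> 1 + 1"
        using norm_exp_ii_self_adjoint[OF sa] by (intro norm_triangle_le) (metis order_refl)
      have "norm ?Y = s * norm A" unfolding Y using nX by simp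
      then show "norm ((exp ?X - (1 + ?X + (1/2) *\<^sub>R (?X * ?X))) + (exp ?Y - (1 + ?Y + (1/2) *\<^sub>R (?Y * ?Y))))
          \<le> M * s ^ 3 + M * s ^ 3"
        by (intro order_trans[OF norm_triangle_ineq] add_mono r nX)
    qed
    finally show ?thesis by simp
  qed
  \<comment> \<open>For \<open>s < s0\<close> this gives \<open>M * s\<close> at most e/2, so with t
    = s^2/2 the cubic error is at most \<open>e * t\<close>. The summand 1 guards against
    \<open>M = 0\<close>.\<close>
  define s0 where "s0 = min 1 (e / (2 * (M + 1)))"
  have M: "M \<ge> 0" by (simp add: M_def)
  have s0: "s0 > 0" using e M by (simp add: s0_def)
  have "norm (1 - t *\<^sub>R (A * A)) \<le> 1 + e * t" if t: "0 < t" "t < s0\<^sup>2 / 2" for t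
  proof -
    define s where "s = sqrt (2 * t)"
    have s2: "s\<^sup>2 = 2 * t" using t by (simp add: s_def)
    have s: "s > 0" using t by (simp add: s_def)
    have "s\<^sup>2 < s0\<^sup>2" using t s2 by simp
    then have ss: "s < s0" using s0 by (simp add: power2_less_imp_less)
    then have "s \<le> 1" by (simp add: s0_def)
    have "M * s \<le> (M + 1) * (e / (2 * (M + 1)))"
      using ss s M by (intro mult_mono) (auto simp: s0_def)
    also have "\<dots> = e / 2" using M by (simp add: field_simps)
    finally have "M * s * s\<^sup>2 \<le> e / 2 * s\<^sup>2" by (rule mult_right_mono) simp
    then have "M * s ^ 3 \<le> e * t" by (simp add: s2 power3_eq_cube power2_eq_square[symmetric] mult_ac)
    then show ?thesis using bd[OF s \<open>s \<le> 1\<close>] by (simp add: s2)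
  qed
  then show "\<exists>d>0. \<forall>t. 0 < t \<and> t < d \<longrightarrow> norm (1 - t *\<^sub>R (A * A)) \<le> 1 + e * t"
    using s0 by (intro exI[of _ "s0\<^sup>2 / 2"]) auto
qed

subsection \<open>Logarithms and positivity\<close>

text \<open>The resolvent identity \<open>diff\<close> is used twice: near \<open>s\<close> it
  bounds the norm of \<open>?G t\<close> by twice that of \<open>?G s\<close>, and with this bound
  it shows that the difference tends to 0.\<close>

lemma continuous_on_cs_inv_path:
  fixes B :: "'a::cstar_algebra"
  assumes inv: "\<And>s. s \<in> S \<Longrightarrow> cs_invertible (1 + s *\<^sub>R B)"
  shows "continuous_on S (\<lambda>s. cs_inv (1 + s *\<^sub>R B))"
  unfolding continuous_on_def
proof
  fix s assume s: "s \<in> S"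
  let ?G = "\<lambda>s. cs_inv (1 + s *\<^sub>R B)"
  define c where "c = norm B * norm (?G s)"
  have diff: "?G t - ?G s = ?G t * ((s - t) *\<^sub>R B) * ?G s" if t: "t \<in> S" for t
  proof -
    have "(s - t) *\<^sub>R B = (1 + s *\<^sub>R B) - (1 + t *\<^sub>R B)" by (simp add: algebra_simps)
    then have "?G t * ((s - t) *\<^sub>R B) * ?G s
        = ?G t * ((1 + s *\<^sub>R B) * ?G s) - (?G t * (1 + t *\<^sub>R B)) * ?G s"
      by (simp only: right_diff_distrib left_diff_distrib mult.assoc)
    then show ?thesis by (simp add: cs_inv_right[OF inv[OF s]] cs_inv_left[OF inv[OF t]])
  qed
  have le: "norm (?G t - ?G s) \<le> 2 * \<bar>s - t\<bar> * c * norm (?G s)" if t: "t \<in> S" "\<bar>s - t\<bar> * c < 1/2" for t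
  proof -
    have 1: "norm (?G t - ?G s) \<le> norm (?G t) * (\<bar>s - t\<bar> * c)"
    proof -
      have "norm (?G t - ?G s) \<le> norm (?G t * ((s - t) *\<^sub>R B)) * norm (?G s)"
        unfolding diff[OF t(1)] by (rule norm_mult_ineq)
      also have "\<dots> \<le> (norm (?G t) * norm ((s - t) *\<^sub>R B)) * norm (?G s)"
        by (intro mult_right_mono norm_mult_ineq) simp
      finally show ?thesis by (simp add: c_def mult_ac)
    qed
    also have "\<dots> \<le> norm (?G t) * (1/2)" using t(2) by (intro mult_left_mono) auto
    finally have "norm (?G t) \<le> 2 * norm (?G s)"
      using norm_triangle_sub[of "?G t" "?G s"] by linarith
    then have "norm (?G t) * (\<bar>s - t\<bar> * c) \<le> (2 * norm (?G s)) * (\<bar>s - t\<bar> * c)"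
      by (rule mult_right_mono) (simp add: c_def)
    with 1 show ?thesis by (simp add: mult_ac)
  qed
  have tend: "((\<lambda>t. \<bar>s - t\<bar> * c) \<longlongrightarrow> 0) (at s within S)"
    by (auto intro!: tendsto_eq_intros)
  then have ev: "\<forall>\<^sub>F t in at s within S. \<bar>s - t\<bar> * c < 1/2" by (rule order_tendstoD(2)) simp
  have "((\<lambda>t. ?G t - ?G s) \<longlongrightarrow> 0) (at s within S)"
  proof (rule Lim_null_comparison)
    show "\<forall>\<^sub>F t in at s within S. norm (?G t - ?G s) \<le> 2 * \<bar>s - t\<bar> * c * norm (?G s)"
      using ev unfolding eventually_at_filter by eventually_elim (use le in blast)
    show "((\<lambda>t. 2 * \<bar>s - t\<bar> * c * norm (?G s)) \<longlongrightarrow> 0) (at s within S)"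
      by (auto intro!: tendsto_eq_intros)
  qed
  then show "(?G \<longlongrightarrow> ?G s) (at s within S)" by (simp add: LIM_zero_iff)
qed

text \<open>The logarithm is $\int_0^1 (A-1)(1+s(A-1))^{-1}\,ds$; with the integral taken up to
  $t$ and called $H(t)$, the product $e^{-H(t)}(1+t(A-1))$ has derivative zero.\<close>
lemma exists_log:
  fixes A :: "'a::cstar_algebra"
  assumes sa: "cstar A = A"
    and inv: "\<And>s. s \<in> {0..1} \<Longrightarrow> cs_invertible (1 + s *\<^sub>R (A - 1))"
  shows "\<exists>H. cstar H = H \<and> exp H = A \<and> (\<forall>X. A * X = X * A \<longrightarrow> H * X = X * H)"
proof -
  define G where "G s = cs_inv (1 + s *\<^sub>R (A - 1))" for s :: real
  define f where "f s = (A - 1) * G s" for s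
  define H where "H t = integral {0..t} f" for t
  have contf: "continuous_on {0..1} f"
    unfolding f_def G_def by (intro continuous_intros continuous_on_cs_inv_path inv)
  have intf: "f integrable_on {0..t}" if "t \<in> {0..1}" for t
    by (rule integrable_continuous_interval, rule continuous_on_subset[OF contf]) (use that in auto)
  have Gl: "G s * (1 + s *\<^sub>R (A - 1)) = 1" and Gr: "(1 + s *\<^sub>R (A - 1)) * G s = 1"
    if "s \<in> {0..1}" for s
    using cs_inv_left[OF inv[OF that]] cs_inv_right[OF inv[OF that]] by (auto simp: G_def)
  have commG: "G s * X = X * G s" if "A * X = X * A" "s \<in> {0..1}" for s X
    unfolding G_def by (rule cs_inv_commute[OF inv[OF that(2)]]) (use that in \<open>simp add: algebra_simps\<close>)
  have commf: "f s * X = X * f s" if "A * X = X * A" "s \<in> {0..1}" for s X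
  proof -
    have "f s * X = (A - 1) * X * G s" using commG[OF that] by (simp add: f_def mult.assoc)
    also have "(A - 1) * X = X * (A - 1)" using that by (simp add: algebra_simps)
    finally show ?thesis by (simp add: f_def mult.assoc)
  qed
  have commH: "H t * X = X * H t" if X: "A * X = X * A" and t: "t \<in> {0..1}" for t X
  proof -
    have "H t * X = integral {0..t} (\<lambda>s. f s * X)"
      using integral_linear[OF intf[OF t] bounded_linear_mult_left[of X]] by (simp add: H_def o_def)
    also have "\<dots> = integral {0..t} (\<lambda>s. X * f s)"
      by (rule integral_cong) (use commf[OF X] t in auto)
    also have "\<dots> = X * H t"
      using integral_linear[OF intf[OF t] bounded_linear_mult_right[of X]] by (simp add: H_def o_def)
    finally show ?thesis .
  qed
  have HA: "A * H t = H t * A" if "t \<in> {0..1}" for t using commH[OF refl that] by simp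
  have saf: "cstar (f s) = f s" if s: "s \<in> {0..1}" for s
  proof -
    have "cstar (G s) * (1 + s *\<^sub>R (A - 1)) = 1"
      using arg_cong[OF Gr[OF s], of cstar]
      by (simp add: cstar_mult cstar_add cstar_scaleR cstar_diff sa)
    then have "cstar (G s) = G s"
      using Gr[OF s] by (metis mult.assoc mult_1_left mult_1_right)
    then have "cstar (f s) = G s * (A - 1)" by (simp add: f_def cstar_mult cstar_diff sa)
    also have "\<dots> = f s" using commG[OF refl s] by (simp add: f_def algebra_simps)
    finally show ?thesis .
  qed
  have saH: "cstar (H 1) = H 1"
  proof -
    have "cstar (H 1) = integral {0..1} (\<lambda>s. cstar (f s))"
      using integral_linear[OF intf bounded_linear_cstar] by (simp add: H_def o_def)
    also have "\<dots> = H 1" unfolding H_def by (rule integral_cong) (use saf in auto)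
    finally show ?thesis .
  qed
  define y where "y t = exp (- H t) * (1 + t *\<^sub>R (A - 1))" for t
  have dH: "(H has_vector_derivative f s) (at s within {0..1})" if "s \<in> {0..1}" for s
    unfolding H_def using integral_has_vector_derivative[OF contf that] .
  have dy: "(y has_derivative (\<lambda>h. 0)) (at s within {0..1})" if s: "s \<in> {0..1}" for s
  proof -
    \<comment> \<open>The values of \<open>H\<close> commute, so exp(-H t) is exp(-H s) times
      \<open>?E t\<close>. The exponent of \<open>?E\<close> vanishes at t = s, where the derivative
      of \<open>exp\<close> is the identity.\<close>
    let ?E = "\<lambda>t. exp (- (H t - H s))"
    have d0: "((\<lambda>t. - (H t - H s)) has_derivative (\<lambda>h. h *\<^sub>R (- f s))) (at s within {0..1})"
      using dH[OF s] unfolding has_vector_derivative_def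
      by (auto intro!: derivative_eq_intros simp: algebra_simps)
    have "(?E has_derivative (\<lambda>h. h *\<^sub>R (- f s))) (at s within {0..1})"
      using has_derivative_compose[OF d0, of exp "\<lambda>h. h"] exp_has_derivative_0 by simp
    then have "(?E has_vector_derivative - f s) (at s within {0..1})"
      by (simp add: has_vector_derivative_def)
    moreover have "((\<lambda>t. 1 + t *\<^sub>R (A - 1)) has_vector_derivative (A - 1)) (at s within {0..1})"
      by (auto intro!: derivative_eq_intros)
    ultimately have "((\<lambda>t. ?E t * (1 + t *\<^sub>R (A - 1))) has_vector_derivative
        (?E s * (A - 1) + (- f s) * (1 + s *\<^sub>R (A - 1)))) (at s within {0..1})"
      by (rule has_vector_derivative_mult)
    also have "?E s * (A - 1) + (- f s) * (1 + s *\<^sub>R (A - 1)) = 0"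
      using Gl[OF s] by (simp add: f_def mult.assoc)
    finally have "((\<lambda>t. ?E t * (1 + t *\<^sub>R (A - 1))) has_derivative (\<lambda>h. 0)) (at s within {0..1})"
      by (simp add: has_vector_derivative_def)
    then have "((\<lambda>t. exp (- H s) * (?E t * (1 + t *\<^sub>R (A - 1)))) has_derivative (\<lambda>h. exp (- H s) * 0)) (at s within {0..1})"
      by (rule has_derivative_mult_right)
    then have der: "((\<lambda>t. exp (- H s) * (?E t * (1 + t *\<^sub>R (A - 1)))) has_derivative (\<lambda>h. 0)) (at s within {0..1})"
      by simp
    have eq: "y t = exp (- H s) * (?E t * (1 + t *\<^sub>R (A - 1)))" if t: "t \<in> {0..1}" for t
    proof -
      have "H s * H t = H t * H s" using commH[OF HA[OF t] s] .
      then have "exp (- H s + - (H t - H s)) = exp (- H s) * ?E t"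
        by (intro exp_add_commuting) (simp add: algebra_simps)
      then show ?thesis by (simp add: y_def mult.assoc)
    qed
    show ?thesis by (rule has_derivative_transform[OF s eq der])
  qed
  have "\<exists>c. \<forall>t\<in>{0..1}. y t = c"
    by (rule has_derivative_zero_constant) (use dy in auto)
  then have "y 1 = y 0" by force
  then have "exp (- H 1) * A = 1" by (simp add: y_def H_def)
  then have "exp (H 1) = A"
    using exp_minus_inverse[of "H 1"] by (metis mult.assoc mult_1_left mult_1_right)
  then show ?thesis using saH commH by (intro exI[of _ "H 1"]) auto
qed

lemma pos_invD:
  assumes "A \<in> pos_inv"
  shows "cs_positive A" "cs_invertible A" "cstar A = A"
  using assms by (auto simp: pos_inv_def cs_positive_def)

text \<open>Inside the segment, 1 + s(A - 1) is s times A + (1 - s)/s, which positivity makes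
  invertible; invertibility of \<open>A\<close> serves the endpoint s = 1. The commutation clause
  lets logarithms and square roots inherit centrality.\<close>

lemma pos_inv_exists_log:
  fixes A :: "'a::cstar_algebra"
  assumes A: "A \<in> pos_inv"
  shows "\<exists>H. cstar H = H \<and> exp H = A \<and> (\<forall>X. A * X = X * A \<longrightarrow> H * X = X * H)"
proof (rule exists_log)
  show "cstar A = A" using pos_invD[OF A] by simp
  fix s :: real assume s: "s \<in> {0..1}"
  show "cs_invertible (1 + s *\<^sub>R (A - 1))"
  proof (cases "s = 0 \<or> s = 1")
    case True
    moreover have "cs_invertible (1::'a)" by (rule cs_invertibleI[of 1 1]) auto
    ultimately show ?thesis using pos_invD[OF A] by auto
  next
    case False
    then have p: "(1 - s) / s > 0" using s by auto
    then have "cs_invertible (A + of_real ((1 - s) / s))"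
      using pos_invD(1)[OF A] by (simp add: cs_positive_iff)
    then have "cs_invertible (s *\<^sub>R (A + of_real ((1 - s) / s)))" using False by (simp add: cs_invertible_scaleR_iff)
    also have "s *\<^sub>R (A + of_real ((1 - s) / s)) = s *\<^sub>R A + (s * ((1 - s) / s)) *\<^sub>R 1"
      by (simp only: of_real_def scaleR_right_distrib scaleR_scaleR)
    also have "\<dots> = 1 + s *\<^sub>R (A - 1)"
      using False by (simp add: scaleR_diff_left scaleR_diff_right)
    finally show ?thesis .
  qed
qed

lemma cs_positive_imp_self_adjoint: "cs_positive A \<Longrightarrow> cstar A = A"
  by (simp add: cs_positive_def)

lemma cs_positive_if_accretive:
  assumes "cstar A = A" "accretive A"
  shows "cs_positive A"
  using accretive_add_of_real_inv(1)[OF assms(2)] assms(1) by (simp add: cs_positive_iff)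

lemma cs_positive_square:
  assumes "cstar A = A"
  shows "cs_positive (A * A)"
  using accretive_square[OF assms] by (intro cs_positive_if_accretive) (simp_all add: cstar_mult assms)

lemma cs_positive_exp:
  assumes "cstar H = H"
  shows "cs_positive (exp H)"
  using cs_positive_square[of "exp ((1/2) *\<^sub>R H)"] by (simp add: exp_half_square cstar_exp cstar_scaleR assms)

lemma exp_pos_inv: "cstar H = H \<Longrightarrow> exp H \<in> pos_inv"
  by (simp add: pos_inv_def cs_positive_exp cs_invertible_exp)

lemma add_of_real_pos_inv:
  assumes "cs_positive A" "e > 0"
  shows "A + of_real e \<in> pos_inv"
proof -
  have "cs_positive (A + of_real e)"
    unfolding cs_positive_iff
  proof (intro conjI allI impI)
    show "cstar (A + of_real e) = A + of_real e"
      using assms by (simp add: cstar_add cs_positive_imp_self_adjoint)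
    fix r :: real assume "r > 0"
    then have "cs_invertible (A + of_real (e + r))" using assms by (simp only: cs_positive_iff add_pos_pos)
    then show "cs_invertible (A + of_real e + of_real r)" by (simp add: add.assoc)
  qed
  then show ?thesis using assms by (simp add: pos_inv_def cs_positive_iff)
qed

text \<open>This is the direction that needs logarithms: A + e/2 equals exp H, the square of the
  self-adjoint exp(H/2), and accretivity survives the limit.\<close>

lemma accretive_if_cs_positive:
  fixes A :: "'a::cstar_algebra"
  assumes A: "cs_positive A"
  shows "accretive A"
proof (rule accretive_near)
  fix e :: real assume e: "e > 0"
  obtain H where H: "cstar H = H" "exp H = A + of_real (e / 2)"
    using pos_inv_exists_log[OF add_of_real_pos_inv[OF A, of "e / 2"]] e by auto
  have "accretive (exp H)"
    using accretive_square[of "exp ((1/2) *\<^sub>R H)"] by (simp add: exp_half_square cstar_exp cstar_scaleR H(1))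
  then show "\<exists>B. accretive B \<and> norm (A - B) < e"
    using e by (intro exI[of _ "exp H"]) (simp add: H(2) del: of_real_divide)
qed

lemma cs_positive_iff_accretive: "cs_positive A \<longleftrightarrow> cstar A = A \<and> accretive A"
  using cs_positive_if_accretive accretive_if_cs_positive cs_positive_imp_self_adjoint by blast

section \<open>The closed cone of positive elements\<close>

lemma cs_positive_add: "cs_positive A \<Longrightarrow> cs_positive B \<Longrightarrow> cs_positive (A + B)"
  by (simp add: cs_positive_iff_accretive accretive_add cstar_add)

lemma cs_positive_scaleR:
  assumes "cs_positive A" "r \<ge> 0"
  shows "cs_positive (r *\<^sub>R A)"
proof (cases "r = 0")
  case True
  then show ?thesis using cs_positive_square[of 0] by simp
next
  case False
  have "cs_invertible (r *\<^sub>R A + of_real s)" if "s > 0" for s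
  proof -
    have "cs_invertible (r *\<^sub>R (A + of_real (s / r)))"
      using assms False that by (simp add: cs_invertible_scaleR_iff cs_positive_iff del: of_real_divide)
    also have "r *\<^sub>R (A + of_real (s / r)) = r *\<^sub>R A + of_real s"
      using False by (simp add: of_real_def algebra_simps del: of_real_divide)
    finally show ?thesis .
  qed
  then show ?thesis using assms by (simp add: cs_positive_iff cstar_scaleR)
qed

text \<open>Approximations below mostly move along a fixed direction \<open>B\<close>, hence this
  form of closedness. \<open>B\<close> may be arbitrary, so self-adjointness of \<open>A\<close> is
  obtained from continuity of the adjoint.\<close>

lemma cs_positive_limit:
  fixes A B :: "'a::cstar_algebra"
  assumes "\<And>e. e > 0 \<Longrightarrow> cs_positive (A + e *\<^sub>R B)"
  shows "cs_positive A"
proof -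
  have "((\<lambda>e. cstar (A + e *\<^sub>R B) - (A + e *\<^sub>R B)) \<longlongrightarrow> cstar (A + 0 *\<^sub>R B) - (A + 0 *\<^sub>R B)) (at_right 0)"
    by (intro tendsto_intros bounded_linear.tendsto[OF bounded_linear_cstar])
  moreover have "\<forall>\<^sub>F e in at_right 0. cstar (A + e *\<^sub>R B) - (A + e *\<^sub>R B) = 0"
    using assms by (auto simp: eventually_at_right_field cs_positive_def intro!: exI[of _ 1])
  then have "((\<lambda>e. cstar (A + e *\<^sub>R B) - (A + e *\<^sub>R B)) \<longlongrightarrow> 0) (at_right 0)"
    by (rule tendsto_eventually)
  ultimately have "cstar (A + 0 *\<^sub>R B) - (A + 0 *\<^sub>R B) = 0"
    by (rule tendsto_unique[OF trivial_limit_at_right_real])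
  then have "cstar A = A" by simp
  moreover have "accretive A"
  proof (rule accretive_near)
    fix e :: real assume e: "e > 0"
    define d where "d = e / (norm B + 1)"
    have p: "norm B + 1 > 0" by (simp add: add_nonneg_pos)
    have d: "d > 0" using e p by (simp add: d_def)
    have "d * norm B < d * (norm B + 1)" using d by simp
    also have "\<dots> = e" using p by (simp add: d_def)
    finally have "norm (A - (A + d *\<^sub>R B)) < e" using d by simp
    then show "\<exists>B. accretive B \<and> norm (A - B) < e"
      using accretive_if_cs_positive[OF assms[OF d]] by blast
  qed
  ultimately show ?thesis by (simp add: cs_positive_if_accretive)
qed

lemma cs_positive_of_real: "r \<ge> 0 \<Longrightarrow> cs_positive (of_real r)"
  using cs_positive_scaleR[OF cs_positive_square[of 1], of r] by (simp add: of_real_def)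

lemma cs_positive_of_real_add: "cstar A = A \<Longrightarrow> norm A \<le> r \<Longrightarrow> cs_positive (of_real r + A)"
  by (intro cs_positive_if_accretive accretive_of_norm_le) (simp_all add: cstar_add)

lemma of_real_add_pos_inv:
  assumes "cstar A = A" "norm A < r"
  shows "of_real r + A \<in> pos_inv"
proof -
  have "of_real (norm A) + A + of_real (r - norm A) \<in> pos_inv"
    using assms by (intro add_of_real_pos_inv cs_positive_of_real_add) auto
  then show ?thesis by (simp add: algebra_simps)
qed

lemma pos_inv_sqrt:
  fixes A :: "'a::cstar_algebra"
  assumes "A \<in> pos_inv"
  obtains K where "cstar K = K" "cs_invertible K" "K * K = A" "\<And>X. A * X = X * A \<Longrightarrow> K * X = X * K"
proof -
  obtain H where H: "cstar H = H" "exp H = A" "\<And>X. A * X = X * A \<Longrightarrow> H * X = X * H"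
    using pos_inv_exists_log[OF assms] by blast
  show thesis
  proof
    show "cstar (exp ((1/2) *\<^sub>R H)) = exp ((1/2) *\<^sub>R H)" by (simp add: cstar_exp cstar_scaleR H)
    show "cs_invertible (exp ((1/2) *\<^sub>R H))" by (rule cs_invertible_exp)
    show "exp ((1/2) *\<^sub>R H) * exp ((1/2) *\<^sub>R H) = A" by (simp add: exp_half_square H)
    show "exp ((1/2) *\<^sub>R H) * X = X * exp ((1/2) *\<^sub>R H)" if "A * X = X * A" for X
      by (rule cs_exp_commute) (simp add: H(3)[OF that])
  qed
qed

section \<open>Inverses, congruences and products of positive elements\<close>

lemma cs_inv_self_adjoint:
  assumes "cs_invertible A" "cstar A = A"
  shows "cstar (cs_inv A) = cs_inv A"
proof -
  have "cstar (cs_inv A) * A = 1"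
    using arg_cong[OF cs_inv_right[OF assms(1)], of cstar] by (simp add: cstar_mult assms)
  then show ?thesis using cs_inv_right[OF assms(1)] by (metis mult.assoc mult_1_left mult_1_right)
qed

text \<open>The spectrum keeps a distance from 0 governed by the norm of the inverse: for r at most
  e, A - (e - r) factors as A(1 - (e - r)A^(-1)), and the second factor is invertible by the Neumann
  series.\<close>

lemma pos_inv_lower_bound:
  fixes A :: "'a::cstar_algebra"
  assumes A: "A \<in> pos_inv"
  shows "\<exists>e>0. cs_positive (A - of_real e)"
proof -
  note inv = pos_invD(2)[OF A]
  define e where "e = 1 / (norm (cs_inv A) + 1)"
  have p: "norm (cs_inv A) + 1 > 0" by (simp add: add_nonneg_pos)
  have e: "e > 0" using p by (simp add: e_def)
  have "cs_invertible (A - of_real e + of_real r)" if r: "r > 0" for r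
  proof (cases "r > e")
    case True
    then have "cs_invertible (A + of_real (r - e))" using pos_invD(1)[OF A] by (simp only: cs_positive_iff diff_gt_0_iff_gt)
    then show ?thesis by (simp add: algebra_simps)
  next
    case False
    have "norm ((e - r) *\<^sub>R cs_inv A) \<le> e * norm (cs_inv A)"
      using False r by (simp add: mult_right_mono)
    also have "\<dots> < 1" using p by (simp add: e_def)
    finally have "cs_invertible (1 - (e - r) *\<^sub>R cs_inv A)" by (intro neumann(1)) simp
    then have "cs_invertible (A * (1 - (e - r) *\<^sub>R cs_inv A))" by (rule cs_invertible_mult[OF inv])
    also have "A * (1 - (e - r) *\<^sub>R cs_inv A) = A - of_real e + of_real r"
      by (simp add: right_diff_distrib cs_inv_right[OF inv] of_real_def algebra_simps)
    finally show ?thesis .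
  qed
  then have "cs_positive (A - of_real e)"
    by (simp add: cs_positive_iff cstar_diff pos_invD(3)[OF A])
  then show ?thesis using e by blast
qed

lemma pos_inv_add:
  assumes "A \<in> pos_inv" "cs_positive B"
  shows "A + B \<in> pos_inv"
proof -
  obtain e where e: "e > 0" "cs_positive (A - of_real e)" using pos_inv_lower_bound[OF assms(1)] by blast
  have "(A - of_real e) + B + of_real e \<in> pos_inv"
    using e assms by (intro add_of_real_pos_inv cs_positive_add)
  then show ?thesis by (simp add: algebra_simps)
qed

lemma pos_inv_cs_inv:
  fixes A :: "'a::cstar_algebra"
  assumes A: "A \<in> pos_inv"
  shows "cs_inv A \<in> pos_inv"
proof -
  obtain H where H: "cstar H = H" "exp H = A" using pos_inv_exists_log[OF A] by blast
  have "exp (- H) * A = 1" using exp_minus_inverse'[of H] by (simp add: H)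
  then have "cs_inv A = exp (- H)"
    using cs_inv_right[OF pos_invD(2)[OF A]] by (metis mult.assoc mult_1_left mult_1_right)
  then show ?thesis using exp_pos_inv[of "- H"] by (simp add: cstar_minus H)
qed

text \<open>With R the inverse of S, SAS + r = S(A + rR^2)S, and A + rR^2 is invertible as the sum
  of a positive and a positive invertible element.\<close>

lemma cs_positive_congruence_invertible:
  fixes A S :: "'a::cstar_algebra"
  assumes A: "cs_positive A" and S: "cstar S = S" "cs_invertible S"
  shows "cs_positive (S * A * S)"
  unfolding cs_positive_iff
proof (intro conjI allI impI)
  show "cstar (S * A * S) = S * A * S"
    using A S by (simp add: cstar_mult cs_positive_def mult.assoc)
  fix r :: real assume r: "r > 0"
  let ?R = "cs_inv S"
  have R: "S * ?R = 1" "?R * S = 1" using cs_inv_left[OF S(2)] cs_inv_right[OF S(2)] by auto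
  have saR: "cstar ?R = ?R" using cs_inv_self_adjoint S by blast
  have "?R * ?R \<in> pos_inv"
    by (simp add: pos_inv_def cs_positive_square[OF saR] cs_invertible_mult cs_invertible_cs_inv S)
  then have "r *\<^sub>R (?R * ?R) \<in> pos_inv"
    using r by (simp add: pos_inv_def cs_positive_scaleR cs_invertible_scaleR_iff)
  then have "cs_invertible (r *\<^sub>R (?R * ?R) + A)" using pos_inv_add[OF _ A] pos_invD(2) by blast
  then have "cs_invertible (S * (r *\<^sub>R (?R * ?R) + A) * S)" by (intro cs_invertible_mult S)
  also have "S * (r *\<^sub>R (?R * ?R) + A) * S = r *\<^sub>R ((S * ?R) * (?R * S)) + S * A * S"
    by (simp add: distrib_left distrib_right mult.assoc)
  also have "\<dots> = S * A * S + of_real r" by (simp add: R of_real_def)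
  finally show "cs_invertible (S * A * S + of_real r)" .
qed

text \<open>The inverse of 1 + YX is 1 - Y(1 + XY)^(-1)X.\<close>

lemma cs_invertible_one_add_swap:
  fixes X Y :: "'a::cstar_algebra"
  assumes "cs_invertible (1 + X * Y)"
  shows "cs_invertible (1 + Y * X)"
proof -
  define Z where "Z = cs_inv (1 + X * Y)"
  have Z: "Z + X * (Y * Z) = 1" "Z + Z * (X * Y) = 1"
    using cs_inv_right[OF assms] cs_inv_left[OF assms] by (simp_all add: Z_def algebra_simps)
  have 1: "Y * (Z + X * (Y * Z)) * X = Y * X" and 2: "Y * (Z + Z * (X * Y)) * X = Y * X"
    unfolding Z by simp_all
  show ?thesis
  proof (rule cs_invertibleI)
    show "(1 + Y * X) * (1 - Y * Z * X) = 1" using 1 by (simp add: algebra_simps)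
    show "(1 - Y * Z * X) * (1 + Y * X) = 1" using 2 by (simp add: algebra_simps)
  qed
qed

text \<open>A singular \<open>S\<close> cannot be moved across, so the invertible factor is taken
  from \<open>A\<close> instead: with A + e = K^2, SAS + eS^2 is the product of SK and KS, and the
  swapped product K(S^2)K is covered by the invertible case.\<close>

lemma cs_positive_congruence:
  fixes A S :: "'a::cstar_algebra"
  assumes A: "cs_positive A" and S: "cstar S = S"
  shows "cs_positive (S * A * S)"
proof (rule cs_positive_limit)
  fix e :: real assume e: "e > 0"
  obtain K where K: "cstar K = K" "cs_invertible K" "K * K = A + of_real e"
    using pos_inv_sqrt[OF add_of_real_pos_inv[OF A e]] by metis
  have "(S * K) * (K * S) = S * (A + of_real e) * S" by (simp only: K(3)[symmetric] mult.assoc)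
  then have eq: "S * A * S + e *\<^sub>R (S * S) = (S * K) * (K * S)"
    by (simp add: algebra_simps of_real_def)
  show "cs_positive (S * A * S + e *\<^sub>R (S * S))"
    unfolding eq cs_positive_iff
  proof (intro conjI allI impI)
    show "cstar (S * K * (K * S)) = S * K * (K * S)" by (simp add: cstar_mult K(1) S mult.assoc)
    fix r :: real assume r: "r > 0"
    have "cs_positive (K * (S * S) * K)"
      by (rule cs_positive_congruence_invertible[OF cs_positive_square[OF S] K(1,2)])
    then have "cs_positive ((1 / r) *\<^sub>R (K * (S * S) * K))" using r by (intro cs_positive_scaleR) auto
    then have "cs_invertible ((1 / r) *\<^sub>R (K * (S * S) * K) + of_real 1)"
      unfolding cs_positive_iff by (meson zero_less_one)
    then have "cs_invertible (1 + ((1 / r) *\<^sub>R (K * S)) * (S * K))" by (simp add: mult.assoc add.commute)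
    then have "cs_invertible (1 + (S * K) * ((1 / r) *\<^sub>R (K * S)))" by (rule cs_invertible_one_add_swap)
    then have "cs_invertible (r *\<^sub>R (1 + (S * K) * ((1 / r) *\<^sub>R (K * S))))" using r by (simp add: cs_invertible_scaleR_iff)
    also have "r *\<^sub>R (1 + (S * K) * ((1 / r) *\<^sub>R (K * S))) = S * K * (K * S) + of_real r"
      using r by (simp add: algebra_simps of_real_def)
    finally show "cs_invertible (S * K * (K * S) + of_real r)" .
  qed
qed

text \<open>The square root \<open>K\<close> of A + e also commutes with \<open>B\<close>, so AB +
  eB = KBK is a congruence of \<open>B\<close>.\<close>

lemma cs_positive_mult_commuting:
  fixes A B :: "'a::cstar_algebra"
  assumes A: "cs_positive A" and B: "cs_positive B" and comm: "A * B = B * A"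
  shows "cs_positive (A * B)"
proof (rule cs_positive_limit)
  fix e :: real assume e: "e > 0"
  obtain K where K: "cstar K = K" "K * K = A + of_real e" "\<And>X. (A + of_real e) * X = X * (A + of_real e) \<Longrightarrow> K * X = X * K"
    using pos_inv_sqrt[OF add_of_real_pos_inv[OF A e]] by metis
  have "K * B = B * K" by (rule K(3)) (simp add: algebra_simps comm of_real_def)
  then have "K * B * K = B * (K * K)" by (simp only: mult.assoc)
  also have "\<dots> = A * B + e *\<^sub>R B" by (simp add: K(2) algebra_simps comm of_real_def)
  finally show "cs_positive (A * B + e *\<^sub>R B)" using cs_positive_congruence[OF B K(1)] by simp
qed

text \<open>With $X$ invertible, $X = (1+Y)^{-1}$ for the positive element $Y = X^{-1} - 1$.\<close>
lemma norm_le_1_if_pos_inv: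
  fixes X :: "'a::cstar_algebra"
  assumes X: "X \<in> pos_inv" and le: "cs_positive (1 - X)"
  shows "norm X \<le> 1"
proof -
  let ?Z = "cs_inv X"
  obtain K where K: "cstar K = K" "cs_invertible K" "K * K = ?Z" "\<And>W. ?Z * W = W * ?Z \<Longrightarrow> K * W = W * K"
    using pos_inv_sqrt[OF pos_inv_cs_inv[OF X]] by metis
  have Z: "?Z * X = 1" "X * ?Z = 1" using cs_inv_left cs_inv_right pos_invD(2)[OF X] by blast+
  have "K * X = X * K" by (rule K(4)) (simp add: Z)
  then have "K * (1 - X) = (1 - X) * K" by (simp add: algebra_simps)
  then have "K * (1 - X) * K = (1 - X) * (K * K)" by (simp only: mult.assoc)
  also have "\<dots> = ?Z - 1" by (simp add: K(3) Z left_diff_distrib)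
  finally have "accretive (?Z - 1)"
    using cs_positive_congruence[OF le K(1)] by (simp add: accretive_if_cs_positive)
  then have "norm (cs_inv (?Z - 1 + of_real 1)) \<le> 1 / 1" by (rule accretive_add_of_real_inv(2)) simp
  moreover have "cs_inv ?Z = X"
    using cs_inv_left[OF cs_invertible_cs_inv[OF pos_invD(2)[OF X]]] Z by (metis mult.assoc mult_1_left mult_1_right)
  ultimately show ?thesis by simp
qed

lemma norm_le_if_cs_positive:
  fixes X :: "'a::cstar_algebra"
  assumes X: "cs_positive X" and le: "cs_positive (of_real r - X)" and r: "r \<ge> 0"
  shows "norm X \<le> r"
proof (rule field_le_epsilon)
  fix e :: real assume e: "e > 0"
  define d where "d = e / 2"
  have d: "d > 0" using e by (simp add: d_def)
  \<comment> \<open>The shift by \<open>d\<close> makes the element invertible, and the factor 1/(r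
    + d) brings it below 1: its difference from 1 is (r - X)/(r + d).\<close>
  let ?Y = "(1 / (r + d)) *\<^sub>R (X + of_real d)"
  have rd: "r + d > 0" using r d by simp
  have "X + of_real d \<in> pos_inv" by (rule add_of_real_pos_inv[OF X d])
  then have 1: "?Y \<in> pos_inv"
    using rd by (simp add: pos_inv_def cs_positive_scaleR cs_invertible_scaleR_iff)
  have "1 - ?Y = (1 / (r + d)) *\<^sub>R ((r + d) *\<^sub>R 1 - (X + of_real d))"
    using rd by (simp add: scaleR_diff_right)
  also have "(r + d) *\<^sub>R 1 - (X + of_real d) = of_real r - X"
    by (simp add: of_real_def algebra_simps)
  finally have 2: "cs_positive (1 - ?Y)" using le rd by (simp add: cs_positive_scaleR)
  have "norm ?Y \<le> 1" by (rule norm_le_1_if_pos_inv[OF 1 2])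
  moreover have "norm ?Y = norm (X + of_real d) / (r + d)" using rd by (simp only: norm_scaleR) simp
  ultimately have "norm (X + of_real d) \<le> r + d" using rd by (simp add: pos_divide_le_eq)
  then have "norm X \<le> r + d + d"
    using norm_triangle_ineq4[of "X + of_real d" "of_real d"] d by simp
  then show "norm X \<le> r + e" by (simp add: d_def)
qed

lemma cs_positive_antisym:
  fixes X :: "'a::cstar_algebra"
  assumes "cs_positive X" "cs_positive (- X)"
  shows "X = 0"
proof -
  have "norm X \<le> 0 + e" if "e > 0" for e
    using assms cs_positive_add[OF assms(2) cs_positive_of_real[of e]] that
    by (intro norm_le_if_cs_positive) (auto simp: add.commute)
  then have "norm X \<le> 0" by (rule field_le_epsilon)
  then show ?thesis by simp
qed


text \<open>If $e^X = 1$ then, positive square roots of $1$ being unique, $e^{X/2^n} = 1$ for all $n$.\<close>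
lemma exp_eq_1_self_adjoint:
  fixes X :: "'a::cstar_algebra"
  assumes sa: "cstar X = X" and X: "exp X = 1"
  shows "X = 0"
proof -
  have half: "exp ((1/2) *\<^sub>R Y) = 1" if Y: "cstar Y = Y" "exp Y = 1" for Y :: 'a
  proof -
    let ?V = "exp ((1/2) *\<^sub>R Y)"
    have "cs_positive ?V" by (rule cs_positive_exp) (simp add: cstar_scaleR Y)
    then have "cs_invertible (?V + of_real 1)" unfolding cs_positive_iff by (meson zero_less_one)
    then have inv: "(?V + 1) * cs_inv (?V + 1) = 1" using cs_inv_right by simp
    have "(?V - 1) * (?V + 1) = 0"
      using exp_half_square[of Y] Y(2) by (simp add: algebra_simps)
    then have "(?V - 1) * ((?V + 1) * cs_inv (?V + 1)) = 0" by (metis mult.assoc mult_zero_left)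
    then show ?thesis unfolding inv by simp
  qed
  have e: "exp ((1 / 2 ^ n) *\<^sub>R X) = 1" for n
  proof (induction n)
    case 0
    then show ?case using X by simp
  next
    case (Suc n)
    then show ?case using half[of "(1 / 2 ^ n) *\<^sub>R X"] by (simp add: cstar_scaleR sa)
  qed
  \<comment> \<open>For Y = X/2^n the second-order remainder of exp Y = 1 gives |Y| <= |Y|^2 exp|Y|,
    that is 2^n |X| <= M for all n.\<close>
  define M where "M = (norm X)\<^sup>2 * exp (norm X)"
  have "2 ^ n * norm X \<le> M" for n
  proof -
    let ?Y = "(1 / 2 ^ n) *\<^sub>R X"
    have "norm ?Y \<le> (norm ?Y)\<^sup>2 * exp (norm ?Y)"
      using norm_exp_remainder[of ?Y 2] by (simp add: numeral_2_eq_2 e)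
    also have "\<dots> \<le> (norm ?Y)\<^sup>2 * exp (norm X)"
      by (intro mult_left_mono) (auto simp: divide_le_eq mult_le_cancel_left1)
    also have "\<dots> = M / 2 ^ n / 2 ^ n" by (simp add: M_def power2_eq_square)
    finally show ?thesis by (simp add: field_simps)
  qed
  moreover have "real n * norm X \<le> 2 ^ n * norm X" for n
    using of_nat_less_two_power[of n, where ?'a = real] by (intro mult_right_mono) auto
  ultimately have "real n * norm X \<le> M" for n by (rule order_trans[rotated])
  then have "\<not> M < real n * norm X" for n by (simp add: not_less)
  then show ?thesis using reals_Archimedean3[of "norm X"] by auto
qed

text \<open>Any self-adjoint logarithm \<open>K\<close> of \<open>exp H\<close> commutes with
  \<open>exp H\<close>, hence with the logarithm \<open>L\<close> built by integration. So exp(K -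
  L) = 1 and K = L, which gives the description in \<open>cs_log\<close> its unique witness.\<close>

lemma cs_log_exp:
  fixes H :: "'a::cstar_algebra"
  assumes H: "cstar H = H"
  shows "cs_log (exp H) = H"
  unfolding cs_log_def
proof (rule the_equality)
  obtain L where L: "cstar L = L" "exp L = exp H" "\<And>X. exp H * X = X * exp H \<Longrightarrow> L * X = X * L"
    using pos_inv_exists_log[OF exp_pos_inv[OF H]] by blast
  have eq: "K = L" if K: "cstar K = K" "exp K = exp H" for K
  proof -
    have "L * K = K * L" using K(2) by (intro L(3)) (metis exp_times_arg_commute)
    then have "exp (K + - L) = exp K * exp (- L)" by (intro exp_add_commuting) simp
    also have "\<dots> = 1" using exp_minus_inverse[of L] by (simp add: K(2) L(2))
    finally show ?thesis using exp_eq_1_self_adjoint[of "K + - L"] by (simp add: cstar_diff K L)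
  qed
  show "K = H" if "cstar K = K \<and> exp K = exp H" for K using eq[of K] eq[of H] that H by simp
qed (simp add: H)

lemma
  fixes A :: "'a::cstar_algebra"
  assumes A: "A \<in> pos_inv"
  shows exp_cs_log: "exp (cs_log A) = A"
    and cstar_cs_log: "cstar (cs_log A) = cs_log A"
    and cs_log_commute: "A * X = X * A \<Longrightarrow> cs_log A * X = X * cs_log A"
proof -
  obtain L where L: "cstar L = L" "exp L = A" "\<And>X. A * X = X * A \<Longrightarrow> L * X = X * L"
    using pos_inv_exists_log[OF A] by blast
  have "cs_log A = L" using cs_log_exp[OF L(1)] L(2) by simp
  then show "exp (cs_log A) = A" "cstar (cs_log A) = cs_log A" "A * X = X * A \<Longrightarrow> cs_log A * X = X * cs_log A"
    using L by auto
qed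

lemma exp_of_real_add:
  fixes H :: "'a::cstar_algebra"
  shows "exp (of_real r + H) = exp r *\<^sub>R exp H"
proof -
  have "exp (of_real r + H) = exp (of_real r) * exp H"
    by (rule exp_add_commuting) (simp add: of_real_def)
  then show ?thesis unfolding exp_of_real by (simp add: of_real_def)
qed

subsection \<open>Traces\<close>

lemma is_traceD:
  assumes "is_trace \<tau>"
  shows trace_add: "\<tau> (x + y) = \<tau> x + \<tau> y"
    and trace_cscale: "\<tau> (cscale a x) = a * \<tau> x"
    and trace_positive: "cs_positive A \<Longrightarrow> \<tau> A \<in> \<real> \<and> 0 \<le> Re (\<tau> A)"
    and trace_commute: "\<tau> (A * B) = \<tau> (B * A)"
  using assms unfolding is_trace_def by blast+

lemma trace_scaleR: "is_trace \<tau> \<Longrightarrow> \<tau> (r *\<^sub>R x) = of_real r * \<tau> x"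
  using trace_cscale[of \<tau> "of_real r" x] by (simp add: cscale_of_real)

lemma trace_zero: "is_trace \<tau> \<Longrightarrow> \<tau> 0 = 0"
  using trace_scaleR[of \<tau> 0 0] by simp

lemma trace_minus: "is_trace \<tau> \<Longrightarrow> \<tau> (- x) = - \<tau> x"
  using trace_scaleR[of \<tau> "-1" x] by simp

lemma trace_diff: "is_trace \<tau> \<Longrightarrow> \<tau> (x - y) = \<tau> x - \<tau> y"
  using trace_add[of \<tau> x "- y"] by (simp add: trace_minus)

lemma trace_self_adjoint:
  assumes t: "is_trace \<tau>" and sa: "cstar X = X"
  shows "\<tau> X \<in> \<real>"
proof -
  let ?r = "of_real (norm X) :: 'a"
  have "\<tau> (?r + X) \<in> \<real>" "\<tau> ?r \<in> \<real>"
    using trace_positive[OF t cs_positive_of_real_add[OF sa order_refl]]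
      trace_positive[OF t cs_positive_of_real[of "norm X"]] by auto
  then have "\<tau> (?r + X) - \<tau> ?r \<in> \<real>" by (rule Reals_diff)
  then show ?thesis by (simp add: trace_add[OF t])
qed

lemma self_adjoint_decomp:
  fixes X :: "'a::cstar_algebra"
  obtains a b where "cstar a = a" "cstar b = b" "X = a + cscale \<i> b"
proof
  let ?a = "cscale (1/2) (X + cstar X)" and ?b = "cscale (- \<i>/2) (X - cstar X)"
  show "cstar ?a = ?a" by (simp add: cstar_cscale cstar_add cstar_cstar add.commute)
  show "cstar ?b = ?b"
    by (simp add: cstar_cscale cstar_diff cstar_cstar cscale_diff_right cscale_minus_left)
  have "?a + cscale \<i> ?b = cscale (1/2 + 1/2) X"
    unfolding cscale_add_left
    by (simp add: cscale_cscale cscale_add_right cscale_diff_right)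
  then show "X = ?a + cscale \<i> ?b" by (simp add: cscale_one)
qed

lemma trace_cstar:
  assumes t: "is_trace \<tau>"
  shows "\<tau> (cstar X) = cnj (\<tau> X)"
proof -
  obtain a b where ab: "cstar a = a" "cstar b = b" "X = a + cscale \<i> b"
    using self_adjoint_decomp by blast
  have "cnj (\<tau> a) = \<tau> a" "cnj (\<tau> b) = \<tau> b"
    using trace_self_adjoint[OF t] ab by (auto simp: Reals_cnj_iff)
  then show ?thesis
    by (simp add: ab cstar_add cstar_cscale trace_add[OF t] trace_cscale[OF t])
qed

lemma faithful_square:
  assumes "faithful \<tau>" "cstar a = a" "\<tau> (a * a) = 0"
  shows "a = 0"
proof -
  have "a * a = 0" using assms cs_positive_square[OF assms(2)] unfolding faithful_def by blast
  then show ?thesis using cstar_square_eq_0[of a] assms(2) by simp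
qed

text \<open>Only self-adjoint test elements are offered, since logarithms provide no others. With Y
  = a + ib, traces of products of two self-adjoint elements are real, so testing against a and b
  isolates the traces of a^2 and b^2.\<close>

lemma trace_nondegenerate:
  fixes Y :: "'a::cstar_algebra"
  assumes t: "is_trace \<tau>" and f: "faithful \<tau>" and z: "\<And>K. cstar K = K \<Longrightarrow> \<tau> (Y * K) = 0"
  shows "Y = 0"
proof -
  obtain a b where ab: "cstar a = a" "cstar b = b" "Y = a + cscale \<i> b"
    using self_adjoint_decomp by blast
  have re: "\<tau> (x * y) \<in> \<real>" if "cstar x = x" "cstar y = y" for x y
  proof -
    have "cnj (\<tau> (x * y)) = \<tau> (y * x)" using trace_cstar[OF t, of "x * y"] by (simp add: cstar_mult that)
    then show ?thesis by (simp add: Reals_cnj_iff trace_commute[OF t, of y x])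
  qed
  have "\<tau> (a * a) + \<i> * \<tau> (b * a) = 0" "\<tau> (a * b) + \<i> * \<tau> (b * b) = 0"
    using z[OF ab(1)] z[OF ab(2)]
    by (simp_all add: ab(3) distrib_right mult_cscale_left trace_add[OF t] trace_cscale[OF t])
  moreover have "\<tau> (a * a) \<in> \<real>" "\<tau> (b * a) \<in> \<real>" "\<tau> (a * b) \<in> \<real>" "\<tau> (b * b) \<in> \<real>"
    using re ab by auto
  ultimately have "\<tau> (a * a) = 0" "\<tau> (b * b) = 0"
    by (auto simp: complex_eq_iff complex_is_Real_iff)
  then show ?thesis using faithful_square[OF f ab(1)] faithful_square[OF f ab(2)] by (simp add: ab(3))
qed

lemma trace_pos_inv:
  assumes t: "is_trace \<tau>" and f: "faithful \<tau>" and A: "A \<in> pos_inv"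
  obtains r where "r > 0" "\<tau> A = complex_of_real r"
proof
  have "\<tau> A \<in> \<real>" "0 \<le> Re (\<tau> A)" using trace_positive[OF t pos_invD(1)[OF A]] by auto
  then show eq: "\<tau> A = complex_of_real (Re (\<tau> A))" by simp
  have "\<tau> A \<noteq> 0"
  proof
    assume "\<tau> A = 0"
    then have "A = 0" using f pos_invD(1)[OF A] unfolding faithful_def by blast
    then show False using cs_inv_right[OF pos_invD(2)[OF A]] by simp
  qed
  then show "Re (\<tau> A) > 0" using \<open>0 \<le> Re (\<tau> A)\<close> eq by (metis of_real_0 order_less_le)
qed

lemma pos_inv_scaleR: "A \<in> pos_inv \<Longrightarrow> r > 0 \<Longrightarrow> r *\<^sub>R A \<in> pos_inv"
  by (simp add: pos_inv_def cs_positive_scaleR cs_invertible_scaleR_iff)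

lemma pos_inv_normalize:
  assumes t: "is_trace \<tau>" and f: "faithful \<tau>" and A: "A \<in> pos_inv"
  obtains r where "r > 0" "(1 / r) *\<^sub>R A \<in> dens \<tau>"
proof -
  obtain r where r: "r > 0" "\<tau> A = complex_of_real r" using trace_pos_inv[OF assms] .
  then have "(1 / r) *\<^sub>R A \<in> dens \<tau>" by (simp add: dens_def pos_inv_scaleR A trace_scaleR[OF t])
  with r show thesis using that by blast
qed

text \<open>Dividing \<open>exp K\<close> by its trace r subtracts ln r from the logarithm; this is
  the scalar \<open>c\<close>.\<close>

lemma dens_log_surj:
  fixes K :: "'a::cstar_algebra"
  assumes t: "is_trace \<tau>" and f: "faithful \<tau>" and K: "cstar K = K"
  obtains B c where "B \<in> dens \<tau>" "cs_log B = of_real c + K"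
proof -
  obtain r where r: "r > 0" "(1 / r) *\<^sub>R exp K \<in> dens \<tau>" using pos_inv_normalize[OF t f exp_pos_inv[OF K]] .
  have "exp (of_real (- ln r) + K) = exp (- ln r) *\<^sub>R exp K" by (rule exp_of_real_add)
  also have "\<dots> = (1 / r) *\<^sub>R exp K" using r by (simp add: exp_minus field_simps)
  finally have "cs_log ((1 / r) *\<^sub>R exp K) = of_real (- ln r) + K"
    using cs_log_exp[of "of_real (- ln r) + K"] by (simp add: cstar_diff K)
  with r show thesis using that by blast
qed

text \<open>Positive invertible elements are multiples of densities, and a self-adjoint A is the
  difference of |A| + 1 + A and |A| + 1. The induction form suits the predicates of lying in the
  domain or the range of a relation.\<close>

lemma dens_span:
  fixes X :: "'a::cstar_algebra"
  assumes t: "is_trace \<tau>" and f: "faithful \<tau>"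
    and add: "\<And>x y. P x \<Longrightarrow> P y \<Longrightarrow> P (x + y)" and scale: "\<And>a x. P x \<Longrightarrow> P (cscale a x)"
    and dens: "\<And>A. A \<in> dens \<tau> \<Longrightarrow> P A"
  shows "P X"
proof -
  have pos: "P A" if A: "A \<in> pos_inv" for A
  proof -
    obtain r where r: "r > 0" "(1 / r) *\<^sub>R A \<in> dens \<tau>" using pos_inv_normalize[OF t f A] .
    then have "P (cscale (of_real r) ((1 / r) *\<^sub>R A))" by (intro scale dens)
    then show ?thesis using r by (simp add: cscale_of_real)
  qed
  have sa: "P A" if A: "cstar A = A" for A
  proof -
    have n: "norm A < norm A + 1" by simp
    have "P (of_real (norm A + 1) + A)" by (rule pos[OF of_real_add_pos_inv[OF A n]])
    moreover have "of_real (norm A + 1) + (0::'a) \<in> pos_inv"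
      by (rule of_real_add_pos_inv) (auto simp: add_nonneg_pos)
    then have "P (cscale (-1) (of_real (norm A + 1)))" by (intro scale pos) simp
    ultimately have "P (of_real (norm A + 1) + A + cscale (-1) (of_real (norm A + 1)))" by (rule add)
    then show ?thesis by (simp add: cscale_minus_left cscale_one)
  qed
  obtain a b where ab: "cstar a = a" "cstar b = b" "X = a + cscale \<i> b"
    using self_adjoint_decomp by blast
  show ?thesis unfolding ab(3) by (intro add scale sa ab)
qed

text \<open>Differences of logarithms reach each self-adjoint element only up to a scalar; the
  condition that \<open>Y\<close> has trace 0 makes that scalar invisible.\<close>

lemma log_nondegenerate:
  fixes Y :: "'a::cstar_algebra"
  assumes t: "is_trace \<tau>" and f: "faithful \<tau>" and Y: "\<tau> Y = 0"
    and z: "\<And>B B'. B \<in> dens \<tau> \<Longrightarrow> B' \<in> dens \<tau> \<Longrightarrow> \<tau> (Y * (cs_log B - cs_log B')) = 0"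
  shows "Y = 0"
proof (rule trace_nondegenerate[OF t f])
  fix K :: 'a assume K: "cstar K = K"
  obtain B c where B: "B \<in> dens \<tau>" "cs_log B = of_real c + K" using dens_log_surj[OF t f K] .
  obtain B' c' where B': "B' \<in> dens \<tau>" "cs_log B' = of_real c' + 0" using dens_log_surj[OF t f cstar_zero] .
  have "Y * (cs_log B - cs_log B') = (c - c') *\<^sub>R Y + Y * K"
    by (simp add: B B' of_real_def algebra_simps)
  then show "\<tau> (Y * K) = 0" using z[OF B(1) B'(1)] Y by (simp add: trace_add[OF t] trace_scaleR[OF t])
qed

subsection \<open>Linear extension of an entropy preserver\<close>

text \<open>Differences of the preserved quantity in its second argument are linear in the first one,
  which identifies $\phi(A)$ by linear conditions; these also define the extension.\<close>
definition entropy_dual ::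
  "('a::cstar_algebra \<Rightarrow> complex) \<Rightarrow> ('b::cstar_algebra \<Rightarrow> complex) \<Rightarrow> ('a \<Rightarrow> 'b) \<Rightarrow> 'a \<Rightarrow> 'b \<Rightarrow> bool" where
  "entropy_dual \<tau> \<omega> \<phi> X Y \<longleftrightarrow> \<omega> Y = \<tau> X \<and>
    (\<forall>B\<in>dens \<tau>. \<forall>B'\<in>dens \<tau>.
      \<omega> (Y * (cs_log (\<phi> B) - cs_log (\<phi> B'))) = \<tau> (X * (cs_log B - cs_log B')))"

text \<open>\<open>entropy_dual\<close> serves as the graph of \<Phi>. It respects linear
  combinations and adjoints and contains all pairs of \<open>A\<close> and \<open>\<phi> A\<close>.
  Since densities span both algebras it is total on both sides, and nondegeneracy makes it
  single-valued on both sides. No formula on linear combinations has to be checked for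
  well-definedness.\<close>

lemma entropy_preserver_extension:
  fixes \<tau> :: "'a::cstar_algebra \<Rightarrow> complex" and \<omega> :: "'b::cstar_algebra \<Rightarrow> complex"
  assumes t: "is_trace \<tau>" and ft: "faithful \<tau>" and w: "is_trace \<omega>" and fw: "faithful \<omega>"
    and surj: "\<phi> ` dens \<tau> = dens \<omega>"
    and pres: "\<And>A B. A \<in> dens \<tau> \<Longrightarrow> B \<in> dens \<tau> \<Longrightarrow> umegaki \<omega> (\<phi> A) (\<phi> B) = umegaki \<tau> A B"
  obtains \<Phi> where "bij \<Phi>" "\<And>x y. \<Phi> (x + y) = \<Phi> x + \<Phi> y" "\<And>a x. \<Phi> (cscale a x) = cscale a (\<Phi> x)"
    "\<And>x. \<Phi> (cstar x) = cstar (\<Phi> x)" "\<And>x. \<omega> (\<Phi> x) = \<tau> x" "\<And>A. A \<in> dens \<tau> \<Longrightarrow> \<Phi> A = \<phi> A"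
    "\<And>x. \<Phi> x \<in> pos_inv \<longleftrightarrow> x \<in> pos_inv"
proof -
  let ?G = "entropy_dual \<tau> \<omega> \<phi>"
  have phi: "\<phi> B \<in> dens \<omega>" if "B \<in> dens \<tau>" for B using surj that by blast
  have Gd: "?G A (\<phi> A)" if A: "A \<in> dens \<tau>" for A
    unfolding entropy_dual_def
  proof (intro conjI ballI)
    show "\<omega> (\<phi> A) = \<tau> A" using A phi[OF A] by (simp add: dens_def)
    fix B B' assume B: "B \<in> dens \<tau>" "B' \<in> dens \<tau>"
    have "\<omega> (\<phi> A * (cs_log (\<phi> B) - cs_log (\<phi> B'))) = umegaki \<omega> (\<phi> A) (\<phi> B') - umegaki \<omega> (\<phi> A) (\<phi> B)"
      by (simp add: umegaki_def trace_diff[OF w] right_diff_distrib)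
    also have "\<dots> = umegaki \<tau> A B' - umegaki \<tau> A B" using A B by (simp add: pres)
    also have "\<dots> = \<tau> (A * (cs_log B - cs_log B'))"
      by (simp add: umegaki_def trace_diff[OF t] right_diff_distrib)
    finally show "\<omega> (\<phi> A * (cs_log (\<phi> B) - cs_log (\<phi> B'))) = \<tau> (A * (cs_log B - cs_log B'))" .
  qed
  have Gadd: "?G (x + x') (y + y')" if "?G x y" "?G x' y'" for x x' y y'
    using that by (simp add: entropy_dual_def trace_add[OF t] trace_add[OF w] distrib_right)
  have Gscale: "?G (cscale a x) (cscale a y)" if "?G x y" for a x y
    using that by (simp add: entropy_dual_def trace_cscale[OF t] trace_cscale[OF w] mult_cscale_left)
  have Gstar: "?G (cstar x) (cstar y)" if G: "?G x y" for x y
    unfolding entropy_dual_def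
  proof (intro conjI ballI)
    show "\<omega> (cstar y) = \<tau> (cstar x)" using G by (simp add: entropy_dual_def trace_cstar t w)
    fix B B' assume B: "B \<in> dens \<tau>" "B' \<in> dens \<tau>"
    have tr: "\<sigma> (cstar z * H) = cnj (\<sigma> (z * H))" if "is_trace \<sigma>" "cstar H = H" for \<sigma> z and H :: "'c::cstar_algebra"
      using trace_cstar[OF that(1), of "H * z"] trace_commute[OF that(1), of z H]
      by (simp add: cstar_mult that(2))
    have "cstar (cs_log B - cs_log B') = cs_log B - cs_log B'"
      "cstar (cs_log (\<phi> B) - cs_log (\<phi> B')) = cs_log (\<phi> B) - cs_log (\<phi> B')"
      using B phi by (auto simp: cstar_diff cstar_cs_log dens_def)
    then show "\<omega> (cstar y * (cs_log (\<phi> B) - cs_log (\<phi> B'))) = \<tau> (cstar x * (cs_log B - cs_log B'))"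
      using G B by (simp add: tr t w entropy_dual_def)
  qed
  have Gdiff: "?G (x - x') (y - y')" if "?G x y" "?G x' y'" for x x' y y'
    using Gadd[OF that(1) Gscale[OF that(2), of "-1"]] by (simp add: cscale_minus_left cscale_one)
  have uniq_r: "y = y'" if G: "?G x y" "?G x y'" for x y y'
  proof -
    have G0: "?G 0 (y - y')" using Gdiff[OF G] by simp
    have "y - y' = 0"
    proof (rule log_nondegenerate[OF w fw])
      show "\<omega> (y - y') = 0" using G0 by (simp add: entropy_dual_def trace_zero[OF t])
      \<comment> \<open>Surjectivity of \<phi> enters here: the logarithms of the elements
        \<open>\<phi> B\<close> are enough test elements on the side of \<omega>.\<close>
      fix C C' assume "C \<in> dens \<omega>" "C' \<in> dens \<omega>"
      then obtain B B' where "B \<in> dens \<tau>" "B' \<in> dens \<tau>" "C = \<phi> B" "C' = \<phi> B'" using surj by blast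
      then show "\<omega> ((y - y') * (cs_log C - cs_log C')) = 0"
        using G0 by (simp add: entropy_dual_def trace_zero[OF t])
    qed
    then show ?thesis by simp
  qed
  have uniq_l: "x = x'" if G: "?G x y" "?G x' y" for x x' y
  proof -
    have G0: "?G (x - x') 0" using Gdiff[OF G] by simp
    have "x - x' = 0"
    proof (rule log_nondegenerate[OF t ft])
      show "\<tau> (x - x') = 0" using G0 by (simp add: entropy_dual_def trace_zero[OF w])
      show "\<tau> ((x - x') * (cs_log B - cs_log B')) = 0" if "B \<in> dens \<tau>" "B' \<in> dens \<tau>" for B B'
        using G0 that by (simp add: entropy_dual_def trace_zero[OF w])
    qed
    then show ?thesis by simp
  qed
  have total_r: "\<exists>y. ?G x y" for x
    by (rule dens_span[OF t ft, where P = "\<lambda>x. \<exists>y. ?G x y"]) (use Gadd Gscale Gd in blast)+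
  have total_l: "\<exists>x. ?G x y" for y
  proof (rule dens_span[OF w fw, where P = "\<lambda>y. \<exists>x. ?G x y"])
    fix C assume "C \<in> dens \<omega>"
    then obtain A where "A \<in> dens \<tau>" "C = \<phi> A" using surj by blast
    then show "\<exists>x. ?G x C" using Gd by blast
  qed (use Gadd Gscale in blast)+
  define \<Phi> where "\<Phi> x = (THE y. ?G x y)" for x
  have G: "?G x (\<Phi> x)" for x unfolding \<Phi>_def using total_r uniq_r by (metis theI)
  have eqI: "\<Phi> x = y" if "?G x y" for x y using uniq_r[OF G that] .
  have bij: "bij \<Phi>"
    unfolding bij_def inj_def surj_def using uniq_l G total_l eqI by metis
  have Phi_scaleR: "\<Phi> (r *\<^sub>R x) = r *\<^sub>R \<Phi> x" for r x
    using eqI[OF Gscale[OF G, of "of_real r" x]] by (simp add: cscale_of_real)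
  have imp: "\<Phi> x \<in> pos_inv" if x: "x \<in> pos_inv" for x
  proof -
    obtain r where r: "r > 0" "(1 / r) *\<^sub>R x \<in> dens \<tau>" using pos_inv_normalize[OF t ft x] .
    then have "\<Phi> ((1 / r) *\<^sub>R x) \<in> pos_inv" using phi eqI[OF Gd] by (simp add: dens_def)
    then have "r *\<^sub>R \<Phi> ((1 / r) *\<^sub>R x) \<in> pos_inv" using r by (intro pos_inv_scaleR)
    then show ?thesis using r by (simp add: Phi_scaleR)
  qed
  have conv: "x \<in> pos_inv" if y: "\<Phi> x \<in> pos_inv" for x
  proof -
    obtain r where r: "r > 0" "(1 / r) *\<^sub>R \<Phi> x \<in> dens \<omega>" using pos_inv_normalize[OF w fw y] .
    then obtain A where A: "A \<in> dens \<tau>" "(1 / r) *\<^sub>R \<Phi> x = \<phi> A" using surj by blast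
    then have "\<Phi> ((1 / r) *\<^sub>R x) = \<Phi> A" using eqI[OF Gd] by (simp add: Phi_scaleR)
    then have "(1 / r) *\<^sub>R x = A" using bij by (simp add: bij_def inj_eq)
    then have "x = r *\<^sub>R A" using r by auto
    then show ?thesis using A r by (simp add: dens_def pos_inv_scaleR)
  qed
  show thesis
  proof
    show "bij \<Phi>" by (rule bij)
    show "\<Phi> (x + y) = \<Phi> x + \<Phi> y" for x y by (rule eqI[OF Gadd[OF G G]])
    show "\<Phi> (cscale a x) = cscale a (\<Phi> x)" for a x by (rule eqI[OF Gscale[OF G]])
    show "\<Phi> (cstar x) = cstar (\<Phi> x)" for x by (rule eqI[OF Gstar[OF G]])
    show "\<omega> (\<Phi> x) = \<tau> x" for x using G by (simp add: entropy_dual_def)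
    show "\<Phi> A = \<phi> A" if "A \<in> dens \<tau>" for A by (rule eqI[OF Gd[OF that]])
    show "\<Phi> x \<in> pos_inv \<longleftrightarrow> x \<in> pos_inv" for x using imp conv by blast
  qed
qed

subsection \<open>Kadison's inequality and Jordan isomorphisms\<close>

text \<open>The extension is known to respect positivity only together with invertibility; x + e is
  invertible for every e > 0, and the image of e shrinks.\<close>

lemma cs_positive_map_of_pos_inv:
  fixes \<Phi> :: "'a::cstar_algebra \<Rightarrow> 'b::cstar_algebra"
  assumes add: "\<And>x y. \<Phi> (x + y) = \<Phi> x + \<Phi> y" and scale: "\<And>r x. \<Phi> (r *\<^sub>R x) = r *\<^sub>R \<Phi> x"
    and pos: "\<And>x. x \<in> pos_inv \<Longrightarrow> \<Phi> x \<in> pos_inv" and x: "cs_positive x"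
  shows "cs_positive (\<Phi> x)"
proof (rule cs_positive_limit)
  fix e :: real assume "e > 0"
  then have "\<Phi> (x + of_real e) \<in> pos_inv" by (intro pos add_of_real_pos_inv x)
  then show "cs_positive (\<Phi> x + e *\<^sub>R \<Phi> 1)" using pos_invD by (simp add: add scale of_real_def)
qed

text \<open>This is the positivity of $\sum_k (m+k-c)\,\Psi(e\,e_k)\,(m+k-c)$ for the Bernstein partition
  $e_k = \binom nk a^k(1-a)^{n-k}$, expanded using the mean and variance of the binomial
  distribution.\<close>
lemma bernstein_positive:
  fixes \<Psi> :: "'a::cstar_algebra \<Rightarrow> 'b::cstar_algebra"
  assumes add: "\<And>x y. \<Psi> (x + y) = \<Psi> x + \<Psi> y"
    and scale: "\<And>r x. \<Psi> (r *\<^sub>R x) = r *\<^sub>R \<Psi> x"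
    and pos: "\<And>x. cs_positive x \<Longrightarrow> cs_positive (\<Psi> x)"
    and a: "cs_positive a" "cs_positive (1 - a)" and c: "cstar c = c"
    and e: "cs_positive e" "e * a = a * e"
  defines "v \<equiv> \<lambda>n m. of_real m + real n *\<^sub>R a"
  defines "w \<equiv> \<lambda>n m. v n m * v n m + real n *\<^sub>R (a * (1 - a))"
  shows "cs_positive (\<Psi> (e * w n m) - c * \<Psi> (e * v n m) - \<Psi> (e * v n m) * c + c * \<Psi> e * c)"
  using e
\<comment> \<open>One Bernoulli trial is split off: with weight a the offset \<open>m\<close> grows
  by 1, with weight 1 - a it stays. Thus e is replaced by ea and e(1 - a), which is why
  \<open>e\<close> and \<open>m\<close> vary in the induction.\<close>
proof (induction n arbitrary: e m)
  case 0
  have "\<Psi> (e * w 0 m) - c * \<Psi> (e * v 0 m) - \<Psi> (e * v 0 m) * c + c * \<Psi> e * c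
      = (of_real m - c) * \<Psi> e * (of_real m - c)"
    by (simp add: v_def w_def of_real_def scale algebra_simps)
  also have "cs_positive \<dots>"
    by (rule cs_positive_congruence[OF pos[OF 0(1)]]) (simp add: cstar_diff c)
  finally show ?case .
next
  case (Suc n)
  let ?f = "\<lambda>n m e. \<Psi> (e * w n m) - c * \<Psi> (e * v n m) - \<Psi> (e * v n m) * c + c * \<Psi> e * c"
  have comm: "e * (1 - a) = (1 - a) * e" using Suc.prems by (simp add: algebra_simps)
  have 1: "cs_positive (?f n (m + 1) (e * a))"
    using Suc.prems a by (intro Suc.IH cs_positive_mult_commuting) (auto simp: mult.assoc)
  have 2: "cs_positive (?f n m (e * (1 - a)))"
    using Suc.prems a comm by (intro Suc.IH cs_positive_mult_commuting) (auto simp: algebra_simps)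
  have va: "v n m * a = a * v n m" by (simp add: v_def of_real_def algebra_simps)
  have v1: "v n (m + 1) = v n m + 1" and vS: "v (Suc n) m = v n m + a"
    by (simp_all add: v_def algebra_simps)
  have v: "v (Suc n) m = a * v n (m + 1) + (1 - a) * v n m"
    unfolding v1 vS by (simp add: algebra_simps)
  have w: "w (Suc n) m = a * w n (m + 1) + (1 - a) * w n m"
    unfolding w_def v1 vS by (simp add: algebra_simps va)
  have ev: "e * v (Suc n) m = e * a * v n (m + 1) + e * (1 - a) * v n m"
    unfolding v by (simp add: distrib_left mult.assoc)
  have ew: "e * w (Suc n) m = e * a * w n (m + 1) + e * (1 - a) * w n m"
    unfolding w by (simp add: distrib_left mult.assoc)
  have ee: "\<Psi> e = \<Psi> (e * a) + \<Psi> (e * (1 - a))"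
    unfolding add[symmetric] by (simp add: algebra_simps)
  have "?f (Suc n) m e = ?f n (m + 1) (e * a) + ?f n m (e * (1 - a))"
    unfolding ev ew add ee by (simp only: distrib_left distrib_right) simp
  then show ?case using cs_positive_add[OF 1 2] by simp
qed

lemma kadison_inequality:
  fixes \<Psi> :: "'a::cstar_algebra \<Rightarrow> 'b::cstar_algebra"
  assumes add: "\<And>x y. \<Psi> (x + y) = \<Psi> x + \<Psi> y"
    and scale: "\<And>r x. \<Psi> (r *\<^sub>R x) = r *\<^sub>R \<Psi> x"
    and pos: "\<And>x. cs_positive x \<Longrightarrow> cs_positive (\<Psi> x)"
    and unital: "\<Psi> 1 = 1" and sa: "cstar X = X"
  shows "cs_positive (\<Psi> (X * X) - \<Psi> X * \<Psi> X)"
proof -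
  have minus: "\<Psi> (- x) = - \<Psi> x" for x using scale[of "-1" x] by simp
  have diff: "\<Psi> (x - y) = \<Psi> x - \<Psi> y" for x y using add[of x "- y"] by (simp add: minus)
  have one: "cs_positive (1::'a)" using cs_positive_of_real[of 1] by simp
  have contr: "cs_positive (\<Psi> (a * a) - \<Psi> a * \<Psi> a)" if a: "cs_positive a" "cs_positive (1 - a)" for a
  proof (rule cs_positive_limit)
    fix e :: real assume e: "e > 0"
    obtain n where n: "n > 0" "inverse (real n) < e" using reals_Archimedean2[of "inverse e"] e
      by (metis inverse_inverse_eq inverse_less_imp_less inverse_positive_iff_positive less_trans
          of_nat_0_less_iff positive_imp_inverse_positive)
    let ?B = "\<Psi> (a * (1 - a))"
    \<comment> \<open>Centred at the image of the binomial mean, the inequality leaves n^2 times the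
      Kadison defect plus n times the variance term \<open>?B\<close>; division by n^2 makes the
      latter negligible.\<close>
    let ?c = "real n *\<^sub>R \<Psi> a"
    have sa': "cstar (\<Psi> a) = \<Psi> a" using pos[OF a(1)] by (rule cs_positive_imp_self_adjoint)
    have "cs_positive (\<Psi> ((real n *\<^sub>R a) * (real n *\<^sub>R a) + real n *\<^sub>R (a * (1 - a))) - ?c * ?c - ?c * ?c + ?c * ?c)"
      using bernstein_positive[OF add scale pos a, where c = ?c and e = 1 and n = n and m = 0] one
      by (simp add: cstar_scaleR sa' scale unital)
    then have "cs_positive ((real n * real n) *\<^sub>R (\<Psi> (a * a) - \<Psi> a * \<Psi> a) + real n *\<^sub>R ?B)"
      by (simp add: add scale scaleR_diff_right diff_add_eq)
    then have "cs_positive ((1 / (real n * real n)) *\<^sub>R ((real n * real n) *\<^sub>R (\<Psi> (a * a) - \<Psi> a * \<Psi> a) + real n *\<^sub>R ?B))"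
      by (rule cs_positive_scaleR) simp
    also have "(1 / (real n * real n)) *\<^sub>R ((real n * real n) *\<^sub>R (\<Psi> (a * a) - \<Psi> a * \<Psi> a) + real n *\<^sub>R ?B)
        = (\<Psi> (a * a) - \<Psi> a * \<Psi> a) + inverse (real n) *\<^sub>R ?B"
    proof -
      have "1 / (real n * real n) * (real n * real n) = 1" "1 / (real n * real n) * real n = inverse (real n)"
        using n by (simp_all add: field_simps)
      then show ?thesis by (simp only: scaleR_right_distrib scaleR_scaleR scaleR_one)
    qed
    finally have 1: "cs_positive ((\<Psi> (a * a) - \<Psi> a * \<Psi> a) + inverse (real n) *\<^sub>R ?B)" .
    have "cs_positive ?B" by (intro pos cs_positive_mult_commuting a) (simp add: algebra_simps)
    then have "cs_positive ((e - inverse (real n)) *\<^sub>R ?B)" using n by (intro cs_positive_scaleR) auto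
    from cs_positive_add[OF 1 this] show "cs_positive (\<Psi> (a * a) - \<Psi> a * \<Psi> a + e *\<^sub>R ?B)"
      by (simp add: scaleR_diff_left)
  qed
  define r where "r = norm X + 1"
  have r: "r > 0" by (simp add: r_def add_nonneg_pos)
  let ?a = "(1 / (2 * r)) *\<^sub>R (of_real r + X)"
  have pa: "cs_positive ?a"
    using r by (intro cs_positive_scaleR cs_positive_of_real_add sa) (simp_all add: r_def)
  have "1 - ?a = (1 / (2 * r)) *\<^sub>R ((2 * r) *\<^sub>R 1 - (of_real r + X))"
    unfolding scaleR_diff_right scaleR_scaleR using r by simp
  also have "(2 * r) *\<^sub>R 1 = of_real r + (of_real r :: 'a)"
    by (simp add: of_real_def flip: scaleR_add_left)
  also have "of_real r + of_real r - (of_real r + X) = of_real r + - X" by simp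
  finally have "1 - ?a = (1 / (2 * r)) *\<^sub>R (of_real r + - X)" .
  moreover have "cs_positive ((1 / (2 * r)) *\<^sub>R (of_real r + - X))"
    using r by (intro cs_positive_scaleR cs_positive_of_real_add) (simp_all add: r_def cstar_minus sa)
  ultimately have pb: "cs_positive (1 - ?a)" by simp
  \<comment> \<open>The defect \<Psi>(x^2) - \<Psi>(x)^2 is unchanged by adding a real scalar to x,
    because \<Psi> is unital, and it scales quadratically; hence the case between 0 and 1
    suffices.\<close>
  have "\<Psi> ((of_real r + X) * (of_real r + X)) - \<Psi> (of_real r + X) * \<Psi> (of_real r + X) = \<Psi> (X * X) - \<Psi> X * \<Psi> X"
    by (simp add: of_real_def add scale unital algebra_simps)
  then have "\<Psi> (?a * ?a) - \<Psi> ?a * \<Psi> ?a = ((1 / (2 * r)) * (1 / (2 * r))) *\<^sub>R (\<Psi> (X * X) - \<Psi> X * \<Psi> X)"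
    by (simp only: mult_scaleR_left mult_scaleR_right scale scaleR_scaleR scaleR_diff_right[symmetric])
  then have "(2 * r * (2 * r)) *\<^sub>R (\<Psi> (?a * ?a) - \<Psi> ?a * \<Psi> ?a) = \<Psi> (X * X) - \<Psi> X * \<Psi> X"
    using r by simp
  moreover have "cs_positive ((2 * r * (2 * r)) *\<^sub>R (\<Psi> (?a * ?a) - \<Psi> ?a * \<Psi> ?a))"
    by (intro cs_positive_scaleR contr pa pb) simp
  ultimately show ?thesis by simp
qed

text \<open>Polarisation of the square of x + y settles self-adjoint arguments; both sides are
  complex bilinear.\<close>

lemma jordan_of_self_adjoint_squares:
  fixes \<Psi> :: "'a::cstar_algebra \<Rightarrow> 'b::cstar_algebra"
  assumes add: "\<And>x y. \<Psi> (x + y) = \<Psi> x + \<Psi> y"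
    and scale: "\<And>r x. \<Psi> (cscale r x) = cscale r (\<Psi> x)"
    and sq: "\<And>X. cstar X = X \<Longrightarrow> \<Psi> (X * X) = \<Psi> X * \<Psi> X"
  shows "\<Psi> (X * Y + Y * X) = \<Psi> X * \<Psi> Y + \<Psi> Y * \<Psi> X"
proof -
  have sa: "\<Psi> (x * y + y * x) = \<Psi> x * \<Psi> y + \<Psi> y * \<Psi> x" if "cstar x = x" "cstar y = y" for x y
  proof -
    have "\<Psi> ((x + y) * (x + y)) = \<Psi> (x + y) * \<Psi> (x + y)" by (rule sq) (simp add: cstar_add that)
    then have "\<Psi> (x * x) + \<Psi> (x * y + y * x) + \<Psi> (y * y) = \<Psi> x * \<Psi> x + (\<Psi> x * \<Psi> y + \<Psi> y * \<Psi> x) + \<Psi> y * \<Psi> y"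
      by (simp add: algebra_simps add)
    then show ?thesis by (simp add: sq that)
  qed
  obtain a b where X: "cstar a = a" "cstar b = b" "X = a + cscale \<i> b" using self_adjoint_decomp by blast
  obtain c d where Y: "cstar c = c" "cstar d = d" "Y = c + cscale \<i> d" using self_adjoint_decomp by blast
  have XY: "X * Y + Y * X = (a * c + c * a) + cscale \<i> (a * d + d * a) + cscale \<i> (b * c + c * b) + cscale (\<i> * \<i>) (b * d + d * b)"
    by (simp only: X Y distrib_left distrib_right mult_cscale_left mult_cscale_right cscale_add_right cscale_cscale) (simp add: add_ac)
  have JXY: "\<Psi> X * \<Psi> Y + \<Psi> Y * \<Psi> X = (\<Psi> a * \<Psi> c + \<Psi> c * \<Psi> a) + cscale \<i> (\<Psi> a * \<Psi> d + \<Psi> d * \<Psi> a) + cscale \<i> (\<Psi> b * \<Psi> c + \<Psi> c * \<Psi> b) + cscale (\<i> * \<i>) (\<Psi> b * \<Psi> d + \<Psi> d * \<Psi> b)"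
    by (simp only: X Y add scale distrib_left distrib_right mult_cscale_left mult_cscale_right cscale_add_right cscale_cscale) (simp add: add_ac)
  show ?thesis
    unfolding XY JXY sa[OF X(1) Y(1), symmetric] sa[OF X(1) Y(2), symmetric]
      sa[OF X(2) Y(1), symmetric] sa[OF X(2) Y(2), symmetric]
    by (simp only: add scale)
qed

lemma unital_order_iso_jordan:
  fixes \<Psi> :: "'a::cstar_algebra \<Rightarrow> 'b::cstar_algebra"
  assumes bij: "bij \<Psi>" and add: "\<And>x y. \<Psi> (x + y) = \<Psi> x + \<Psi> y"
    and scale: "\<And>r x. \<Psi> (cscale r x) = cscale r (\<Psi> x)" and star: "\<And>x. \<Psi> (cstar x) = cstar (\<Psi> x)"
    and pos: "\<And>x. cs_positive (\<Psi> x) \<longleftrightarrow> cs_positive x" and unital: "\<Psi> 1 = 1"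
  shows "jordan_star_iso \<Psi>"
proof -
  have scaleR: "\<Psi> (r *\<^sub>R x) = r *\<^sub>R \<Psi> x" for r x using scale[of "of_real r" x] by (simp add: cscale_of_real)
  let ?I = "inv \<Psi>"
  have I: "\<Psi> (?I y) = y" "?I (\<Psi> x) = x" for x y
    using bij by (auto simp: bij_is_surj surj_f_inv_f bij_is_inj)
  have inj: "x = y" if "\<Psi> x = \<Psi> y" for x y using bij that by (simp add: bij_def inj_eq)
  have sq: "\<Psi> (X * X) = \<Psi> X * \<Psi> X" if sa: "cstar X = X" for X
  proof -
    have 1: "cs_positive (\<Psi> (X * X) - \<Psi> X * \<Psi> X)"
      using sa pos by (intro kadison_inequality add scaleR unital) auto
    \<comment> \<open>Carried back by \<Psi>, Kadison's inequality for the inverse at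
      \<open>\<Psi> X\<close> is the reverse of the first one.\<close>
    have "cs_positive (?I (\<Psi> X * \<Psi> X) - ?I (\<Psi> X) * ?I (\<Psi> X))"
    proof (rule kadison_inequality)
      show "?I (x + y) = ?I x + ?I y" for x y by (rule inj) (simp add: I add)
      show "?I (r *\<^sub>R x) = r *\<^sub>R ?I x" for r x by (rule inj) (simp add: I scaleR)
      show "cs_positive (?I x)" if "cs_positive x" for x using that pos[of "?I x"] by (simp add: I)
      show "?I 1 = 1" by (rule inj) (simp add: I unital)
      show "cstar (\<Psi> X) = \<Psi> X" using star[of X] sa by simp
    qed
    then have "cs_positive (?I (\<Psi> X * \<Psi> X) + (-1) *\<^sub>R (X * X))" by (simp add: I)
    then have "cs_positive (- (\<Psi> (X * X) - \<Psi> X * \<Psi> X))"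
      unfolding pos[symmetric] add scaleR I by simp
    from cs_positive_antisym[OF 1 this] show ?thesis by simp
  qed
  have "\<Psi> (X * Y + Y * X) = \<Psi> X * \<Psi> Y + \<Psi> Y * \<Psi> X" for X Y
    using add scale sq by (rule jordan_of_self_adjoint_squares)
  then show ?thesis
    unfolding jordan_star_iso_def by (simp add: bij add scale star)
qed

text \<open>The associator $(X \circ Y) \circ Z - X \circ (Y \circ Z)$ of the Jordan product is
  $[Y,[X,Z]]/4$, on which $\tau = \omega(D\,J(\cdot))$ vanishes.\<close>
lemma jordan_trace_central:
  fixes J :: "'a::cstar_algebra \<Rightarrow> 'b::cstar_algebra"
  assumes t: "is_trace \<tau>" and w: "is_trace \<omega>" and fw: "faithful \<omega>" and J: "jordan_star_iso J"
    and D: "cstar D = D" and tr: "\<And>X. \<omega> (D * J X) = \<tau> X"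
  shows "D * Y = Y * D"
proof -
  have surj: "\<exists>x. J x = y" for y using J unfolding jordan_star_iso_def by (metis bij_pointE)
  have add: "J (x + y) = J x + J y" and scale: "J (cscale a x) = cscale a (J x)"
    and jord: "J (x * y + y * x) = J x * J y + J y * J x" for x y a
    using J unfolding jordan_star_iso_def by blast+
  have diff: "J (x - y) = J x - J y" for x y
    using add[of x "cscale (-1) y"] by (simp add: scale) (simp add: cscale_minus_left cscale_one)
  define a where "a x y = x * y + y * x" for x y :: 'a
  define b where "b x y = x * y + y * x" for x y :: 'b
  have Jb: "J (a x y) = b (J x) (J y)" for x y by (simp add: a_def b_def jord)
  have "\<omega> (D * (b (b x y) z - b x (b y z))) = 0" for x y z
  proof -
    obtain x' y' z' where xyz: "J x' = x" "J y' = y" "J z' = z" using surj by metis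
    have "\<omega> (D * (b (b x y) z - b x (b y z))) = \<tau> (a (a x' y') z' - a x' (a y' z'))"
      by (simp add: tr[symmetric] diff Jb xyz)
    also have "a (a x' y') z' - a x' (a y' z') = y' * (x' * z' - z' * x') - (x' * z' - z' * x') * y'"
      by (simp add: a_def algebra_simps)
    finally show ?thesis by (simp add: trace_diff[OF t] trace_commute[OF t, of y'])
  qed
  moreover have "b (b x y) z - b x (b y z) = y * (x * z - z * x) - (x * z - z * x) * y" for x y z
    by (simp add: b_def algebra_simps)
  ultimately have 0: "\<omega> (D * (y * (x * z - z * x) - (x * z - z * x) * y)) = 0" for x y z by metis
  have sa: "D * y = y * D" if y: "cstar y = y" for y
  proof -
    let ?W = "D * y - y * D"
    have "\<omega> (D * (?W * y)) = \<omega> (y * (D * ?W))"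
      using trace_commute[OF w, of "D * ?W" y] by (simp add: mult.assoc)
    then have "\<omega> (?W * ?W) = \<omega> (D * (y * ?W - ?W * y))"
      by (simp add: left_diff_distrib[of "D * y"] right_diff_distrib[of D] trace_diff[OF w] mult.assoc)
    then have ww: "\<omega> (?W * ?W) = 0" using 0 by simp
    \<comment> \<open>The commutator of two self-adjoint elements is skew-adjoint, so faithfulness
      is applied to \<i> times it.\<close>
    have "cscale \<i> ?W = 0"
    proof (rule faithful_square[OF fw])
      show "cstar (cscale \<i> ?W) = cscale \<i> ?W"
        by (simp add: cstar_cscale cstar_diff cstar_mult D y cscale_minus_left cscale_diff_right)
      show "\<omega> (cscale \<i> ?W * cscale \<i> ?W) = 0"
        by (simp only: mult_cscale_left mult_cscale_right trace_cscale[OF w] ww mult_zero_right)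
    qed
    then have "norm ?W = 0" using norm_cscale[of \<i> ?W] by simp
    then show ?thesis by simp
  qed
  obtain a b where ab: "cstar a = a" "cstar b = b" "Y = a + cscale \<i> b" using self_adjoint_decomp by blast
  show ?thesis by (simp add: ab distrib_left distrib_right mult_cscale_left mult_cscale_right sa)
qed

subsection \<open>Entropy preservers and the standard form\<close>

lemma standard_form_if_entropy_preserver:
  fixes \<tau> :: "'a::cstar_algebra \<Rightarrow> complex" and \<omega> :: "'b::cstar_algebra \<Rightarrow> complex"
  assumes t: "is_trace \<tau>" and ft: "faithful \<tau>" and w: "is_trace \<omega>" and fw: "faithful \<omega>"
    and surj: "\<phi> ` dens \<tau> = dens \<omega>"
    and pres: "\<And>A B. A \<in> dens \<tau> \<Longrightarrow> B \<in> dens \<tau> \<Longrightarrow> umegaki \<omega> (\<phi> A) (\<phi> B) = umegaki \<tau> A B"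
  shows "standard_form \<tau> \<omega> \<phi>"
proof (rule entropy_preserver_extension[OF t ft w fw surj])
  show "umegaki \<omega> (\<phi> A) (\<phi> B) = umegaki \<tau> A B" if "A \<in> dens \<tau>" "B \<in> dens \<tau>" for A B
    using pres that .
next
  fix \<Phi> assume bij: "bij \<Phi>" and add: "\<And>x y. \<Phi> (x + y) = \<Phi> x + \<Phi> y"
    and scale: "\<And>a x. \<Phi> (cscale a x) = cscale a (\<Phi> x)" and star: "\<And>x. \<Phi> (cstar x) = cstar (\<Phi> x)"
    and tr: "\<And>x. \<omega> (\<Phi> x) = \<tau> x" and ext: "\<And>A. A \<in> dens \<tau> \<Longrightarrow> \<Phi> A = \<phi> A"
    and pinv: "\<And>x. \<Phi> x \<in> pos_inv \<longleftrightarrow> x \<in> pos_inv"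
  have scaleR: "\<Phi> (r *\<^sub>R x) = r *\<^sub>R \<Phi> x" for r x using scale[of "of_real r" x] by (simp add: cscale_of_real)
  let ?I = "inv \<Phi>"
  have I: "\<Phi> (?I y) = y" "?I (\<Phi> x) = x" for x y
    using bij by (auto simp: bij_is_surj surj_f_inv_f bij_is_inj)
  have inj: "x = y" if "\<Phi> x = \<Phi> y" for x y using bij that by (simp add: bij_def inj_eq)
  have pos1: "cs_positive (\<Phi> x)" if "cs_positive x" for x
    by (rule cs_positive_map_of_pos_inv[OF add scaleR _ that]) (simp add: pinv)
  have pos2: "cs_positive x" if "cs_positive (\<Phi> x)" for x
  proof -
    have "cs_positive (?I (\<Phi> x))"
    proof (rule cs_positive_map_of_pos_inv[where \<Phi> = ?I])
      show "?I (x + y) = ?I x + ?I y" for x y by (rule inj) (simp add: I add)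
      show "?I (r *\<^sub>R x) = r *\<^sub>R ?I x" for r x by (rule inj) (simp add: I scaleR)
      show "?I x \<in> pos_inv" if "x \<in> pos_inv" for x using that pinv[of "?I x"] by (simp add: I)
      show "cs_positive (\<Phi> x)" by fact
    qed
    then show ?thesis by (simp add: I)
  qed
  define D where "D = \<Phi> 1"
  have "(1::'a) \<in> pos_inv" using exp_pos_inv[of "0::'a"] by simp
  then have D: "D \<in> pos_inv" by (simp add: D_def pinv)
  obtain K where K: "cstar K = K" "cs_invertible K" "K * K = D" "\<And>X. D * X = X * D \<Longrightarrow> K * X = X * K"
    using pos_inv_sqrt[OF D] by metis
  define S where "S = cs_inv K"
  have S: "S * K = 1" "K * S = 1" using K(2) by (simp_all add: S_def cs_inv_left cs_inv_right)
  have saS: "cstar S = S" unfolding S_def by (rule cs_inv_self_adjoint[OF K(2,1)])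
  define J where "J X = S * \<Phi> X * S" for X
  have KJK: "K * J X * K = \<Phi> X" for X
  proof -
    have "K * J X * K = (K * S) * \<Phi> X * (S * K)" unfolding J_def by (simp only: mult.assoc)
    then show ?thesis by (simp add: S)
  qed
  have J: "jordan_star_iso J"
  proof (rule unital_order_iso_jordan)
    have "\<exists>x. J x = y" for y
    proof
      have "J (?I (K * y * K)) = (S * K) * y * (K * S)" unfolding J_def I by (simp only: mult.assoc)
      then show "J (?I (K * y * K)) = y" by (simp add: S)
    qed
    moreover have "x = y" if "J x = J y" for x y using KJK[of x] KJK[of y] that by (simp add: inj)
    ultimately show "bij J" unfolding bij_def inj_def surj_def by metis
    show "J (x + y) = J x + J y" for x y by (simp add: J_def add algebra_simps)
    show "J (cscale r x) = cscale r (J x)" for r x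
      by (simp add: J_def scale mult_cscale_left mult_cscale_right)
    show "J (cstar x) = cstar (J x)" for x by (simp add: J_def star cstar_mult saS mult.assoc)
    show "cs_positive (J x) \<longleftrightarrow> cs_positive x" for x
    proof
      assume "cs_positive (J x)"
      then have "cs_positive (K * J x * K)" by (rule cs_positive_congruence[OF _ K(1)])
      then show "cs_positive x" unfolding KJK by (rule pos2)
    next
      assume "cs_positive x"
      then show "cs_positive (J x)" unfolding J_def by (intro cs_positive_congruence pos1 saS)
    qed
    have "J 1 = (S * K) * (K * S)" unfolding J_def D_def[symmetric] K(3)[symmetric] by (simp only: mult.assoc)
    then show "J 1 = 1" by (simp add: S)
  qed
  \<comment> \<open>Centrality of \<open>D\<close> is not yet available; cyclicity of the trace
    alone turns \<open>K * K * J X\<close> into \<open>K * J X * K\<close>.\<close>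
  have wDJ: "\<omega> (D * J X) = \<tau> X" for X
    using trace_commute[OF w, of K "K * J X"] KJK[of X] tr[of X] by (simp add: K(3)[symmetric] mult.assoc)
  have central: "D * Y = Y * D" for Y
    by (rule jordan_trace_central[OF t w fw J pos_invD(3)[OF D] wDJ])
  \<comment> \<open>The square root \<open>K\<close> commutes with whatever commutes with
    \<open>D\<close>, so it is central as well and both factors can be collected on the
    left.\<close>
  have DJ: "\<Phi> X = D * J X" for X
    unfolding KJK[symmetric, of X] mult.assoc K(4)[OF central, of "J X", symmetric] by (simp add: K(3)[symmetric] mult.assoc)
  have "\<phi> A = D * J A" if "A \<in> dens \<tau>" for A using ext[OF that] DJ[of A] by simp
  then show ?thesis unfolding standard_form_def using D central J wDJ by blast
qed

section \<open>Order, norm bounds and exponentials under Jordan isomorphisms\<close>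

lemma jordan_star_isoD:
  assumes "jordan_star_iso J"
  shows jordan_add: "J (x + y) = J x + J y"
    and jordan_cscale: "J (cscale a x) = cscale a (J x)"
    and jordan_mult: "J (x * y + y * x) = J x * J y + J y * J x"
    and jordan_cstar: "J (cstar x) = cstar (J x)"
    and jordan_surj: "\<exists>x. J x = z"
  using assms unfolding jordan_star_iso_def by (blast, blast, blast, blast, metis bij_pointE)

lemma jordan_scaleR: "jordan_star_iso J \<Longrightarrow> J (r *\<^sub>R x) = r *\<^sub>R J x"
  using jordan_cscale[of J "of_real r" x] by (simp add: cscale_of_real)

lemma jordan_minus: "jordan_star_iso J \<Longrightarrow> J (- x) = - J x"
  using jordan_scaleR[of J "-1" x] by simp

lemma jordan_diff: "jordan_star_iso J \<Longrightarrow> J (x - y) = J x - J y"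
  using jordan_add[of J x "- y"] by (simp add: jordan_minus)

text \<open>The Jordan product of 1 with a preimage x of 1 is 2x, and its image is 2 J(1).\<close>

lemma jordan_one:
  assumes J: "jordan_star_iso J"
  shows "J 1 = 1"
proof -
  obtain x where x: "J x = 1" using jordan_surj[OF J] by blast
  have "2 *\<^sub>R J x = 2 *\<^sub>R J 1"
    using jordan_mult[OF J, of x 1] by (simp add: jordan_add[OF J] x scaleR_2)
  then show ?thesis by (simp add: x)
qed

lemma jordan_power:
  assumes J: "jordan_star_iso J"
  shows "J (x ^ n) = J x ^ n"
proof (induction n)
  case 0
  then show ?case by (simp add: jordan_one[OF J])
next
  case (Suc n)
  have "J (x ^ Suc n + x ^ Suc n) = J (x * x ^ n + x ^ n * x)" by (simp add: power_commutes)
  also have "\<dots> = J x ^ Suc n + J x ^ Suc n"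
    unfolding jordan_mult[OF J] Suc by (simp add: power_commutes)
  finally have "2 *\<^sub>R J (x ^ Suc n) = 2 *\<^sub>R J x ^ Suc n" by (simp only: scaleR_2 jordan_add[OF J])
  then show ?case by simp
qed

lemma jordan_positive:
  assumes J: "jordan_star_iso J" and x: "cs_positive x"
  shows "cs_positive (J x)"
proof (rule cs_positive_limit)
  fix e :: real assume "e > 0"
  then obtain K where K: "cstar K = K" "K * K = x + of_real e"
    using pos_inv_sqrt[OF add_of_real_pos_inv[OF x]] by metis
  have "J x + e *\<^sub>R 1 = J (K * K)"
    by (simp add: K jordan_add[OF J] of_real_def jordan_scaleR[OF J] jordan_one[OF J])
  also have "\<dots> = J K * J K" using jordan_power[OF J, of K 2] by (simp add: power2_eq_square)
  also have "cs_positive \<dots>" by (rule cs_positive_square) (simp add: jordan_cstar[OF J, symmetric] K)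
  finally show "cs_positive (J x + e *\<^sub>R 1)" .
qed

text \<open>Continuity is not part of the definition and is recovered from the order: |x| + J x lies
  between 0 and 2|x|, so its norm is at most 2|x|, and removing the scalar adds another |x|.\<close>

lemma jordan_norm_le:
  assumes J: "jordan_star_iso J" and x: "cstar x = x"
  shows "norm (J x) \<le> 3 * norm x"
proof -
  let ?r = "norm x"
  have "cs_positive (J (of_real ?r + x))" by (intro jordan_positive[OF J] cs_positive_of_real_add x) simp
  then have 1: "cs_positive (of_real ?r + J x)"
    by (simp add: jordan_add[OF J] of_real_def jordan_scaleR[OF J] jordan_one[OF J])
  have "cs_positive (J (of_real ?r + (- x)))"
    by (intro jordan_positive[OF J] cs_positive_of_real_add) (auto simp: cstar_minus x)
  then have "cs_positive (of_real ?r - J x)"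
    by (simp add: jordan_diff[OF J] of_real_def jordan_scaleR[OF J] jordan_one[OF J])
  moreover have "of_real (2 * ?r) - (of_real ?r + J x) = of_real ?r - J x"
    by (simp only: mult_2 of_real_add) simp
  ultimately have "cs_positive (of_real (2 * ?r) - (of_real ?r + J x))" by (simp only:)
  with 1 have "norm (of_real ?r + J x) \<le> 2 * ?r" by (rule norm_le_if_cs_positive) simp
  then show ?thesis using norm_triangle_ineq4[of "of_real ?r + J x" "of_real ?r"] by simp
qed

text \<open>The norm bound covers self-adjoint elements only. This is enough, because the partial
  sums of exp H and their limit are self-adjoint.\<close>

lemma jordan_exp:
  assumes J: "jordan_star_iso J" and H: "cstar H = H"
  shows "J (exp H) = exp (J H)"
proof -
  let ?p = "\<lambda>n. \<Sum>k<n. H ^ k /\<^sub>R fact k"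
  have J0: "J 0 = 0" using jordan_scaleR[OF J, of 0 0] by simp
  have Jp: "J (?p n) = (\<Sum>k<n. J H ^ k /\<^sub>R fact k)" for n
    by (induction n) (simp_all add: J0 jordan_add[OF J] jordan_scaleR[OF J] jordan_power[OF J])
  have sap: "cstar (?p n) = ?p n" for n
    by (induction n) (simp_all add: cstar_add cstar_scaleR cstar_power H)
  have lim: "?p \<longlonglongrightarrow> exp H" using exp_converges[of H] by (simp add: sums_def)
  have "(\<lambda>n. J (?p n) - J (exp H)) \<longlonglongrightarrow> 0"
  proof (rule Lim_null_comparison)
    show "\<forall>\<^sub>F n in sequentially. norm (J (?p n) - J (exp H)) \<le> 3 * norm (?p n - exp H)"
    proof (rule always_eventually, rule allI)
      show "norm (J (?p n) - J (exp H)) \<le> 3 * norm (?p n - exp H)" for n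
        unfolding jordan_diff[OF J, symmetric]
        by (rule jordan_norm_le[OF J]) (simp add: cstar_diff sap cstar_exp H)
    qed
    show "(\<lambda>n. 3 * norm (?p n - exp H)) \<longlonglongrightarrow> 0"
      using lim by (auto intro!: tendsto_mult_right_zero tendsto_norm_zero LIM_zero)
  qed
  then have "(\<lambda>n. J (?p n)) \<longlonglongrightarrow> J (exp H)" by (simp only: LIM_zero_iff)
  moreover have "(\<lambda>n. J (?p n)) \<longlonglongrightarrow> exp (J H)"
    unfolding Jp using exp_converges[of "J H"] by (simp add: sums_def)
  ultimately show ?thesis by (rule LIMSEQ_unique)
qed

lemma entropy_preserver_if_standard_form:
  fixes \<tau> :: "'a::cstar_algebra \<Rightarrow> complex" and \<omega> :: "'b::cstar_algebra \<Rightarrow> complex"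
  assumes t: "is_trace \<tau>" and w: "is_trace \<omega>" and sf: "standard_form \<tau> \<omega> \<phi>"
    and A: "A \<in> dens \<tau>" and B: "B \<in> dens \<tau>"
  shows "umegaki \<omega> (\<phi> A) (\<phi> B) = umegaki \<tau> A B"
proof -
  obtain C J where C: "C \<in> pos_inv" "\<And>Y. C * Y = Y * C" and J: "jordan_star_iso J"
    and phi: "\<And>A. A \<in> dens \<tau> \<Longrightarrow> \<phi> A = C * J A" and tr: "\<And>X. \<omega> (C * J X) = \<tau> X"
    using sf unfolding standard_form_def by blast
  define L where "L = cs_log C"
  have L: "cstar L = L" "exp L = C" "\<And>X. L * X = X * L"
    using C by (simp_all add: L_def cstar_cs_log exp_cs_log cs_log_commute)
  have log: "cs_log (\<phi> X) = L + J (cs_log X)" if X: "X \<in> dens \<tau>" for X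
  proof -
    let ?H = "cs_log X"
    have H: "cstar ?H = ?H" "exp ?H = X" using X by (auto simp: dens_def cstar_cs_log exp_cs_log)
    have "\<phi> X = exp L * exp (J ?H)" by (simp add: phi X L(2) jordan_exp[OF J H(1), symmetric] H(2))
    also have "\<dots> = exp (L + J ?H)" using L(3) by (intro exp_add_commuting[symmetric]) blast
    finally show ?thesis
      by (simp add: cs_log_exp cstar_add L(1) jordan_cstar[OF J, symmetric] H(1))
  qed
  define Y where "Y = cs_log A - cs_log B"
  have "cs_log (\<phi> A) - cs_log (\<phi> B) = J Y" by (simp add: log A B Y_def jordan_diff[OF J])
  then have U: "umegaki \<omega> (\<phi> A) (\<phi> B) = \<omega> (C * J A * J Y)" by (simp add: umegaki_def phi A)
  \<comment> \<open>\<open>J\<close> respects only the symmetrised product, so the two orders of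
    \<open>J A\<close> and \<open>J Y\<close> are averaged; they have equal trace because
    \<open>C\<close> is central.\<close>
  have "\<omega> (C * (J Y * J A)) = \<omega> (C * J A * J Y)"
    using trace_commute[OF w, of "J Y" "C * J A"] C(2)[of "J Y"] by (simp add: mult.assoc[symmetric])
  then have "2 * \<omega> (C * J A * J Y) = \<omega> (C * (J A * J Y + J Y * J A))"
    by (simp add: distrib_left trace_add[OF w] mult.assoc)
  also have "\<dots> = \<tau> (A * Y + Y * A)" by (simp add: jordan_mult[OF J, symmetric] tr)
  also have "\<dots> = 2 * \<tau> (A * Y)" by (simp add: trace_add[OF t] trace_commute[OF t, of Y A])
  finally show ?thesis unfolding U by (simp add: umegaki_def Y_def)
qed

theorem theorem5:
  fixes \<tau> :: "'a::cstar_algebra \<Rightarrow> complex"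
    and \<omega> :: "'b::cstar_algebra \<Rightarrow> complex"
    and \<phi> :: "'a \<Rightarrow> 'b"
  assumes "is_trace \<tau>" and "faithful \<tau>"
    and "is_trace \<omega>" and "faithful \<omega>"
    and "\<phi> ` dens \<tau> = dens \<omega>"
  shows "(\<forall>A \<in> dens \<tau>. \<forall>B \<in> dens \<tau>. umegaki \<omega> (\<phi> A) (\<phi> B) = umegaki \<tau> A B)
         \<longleftrightarrow> standard_form \<tau> \<omega> \<phi>"
  using standard_form_if_entropy_preserver[OF assms]
    entropy_preserver_if_standard_form[OF assms(1,3)] by blast

end
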